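(* There is a universal constant $c>0$ such that the following holds for all $N,n,d\in\mathbb{N}$. Let $X=(X_1,\dots,X_N)$ and let $f_1,\dots,f_n\in\mathbb{Z}[X]$ be polynomials of degree $\leq d$. Then the $\mathbb{Z}[X]$-module of solutions $(y_1,\dots,y_n)\in(\mathbb{Z}[X])^n$ of the equation $$f_1y_1+\cdots+f_ny_n=0$$ is generated by finitely many solutions $y^{(1)},\dots,y^{(K)}\in(\mathbb{Z}[X])^n$ all of whose entries are of degree $\leq(2d)^{2^{cN^2}}$.
   Context: Here $\mathbb{N}=\{0,1,2,\dots\}$. Degree means total degree, with $\deg(0)=-\infty$. (The paper writes the bound as $(2d)^{2^{O(N^2)}}$; the constant hidden in the $O$-notation is universal.) *)

theory Defs
  imports Complex_Main "HOL-Library.Poly_Mapping" "HOL-Library.FuncSet"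
    "HOL-Library.Extended_Real"
begin

text \<open>
  A monomial is its finitely supported exponent map, and multiplication of polynomials is the
  convolution product of \<^theory>\<open>HOL-Library.Poly_Mapping\<close>. The type has countably many variables;
  \<open>X\<^sub>1, \<dots>, X\<^sub>N\<close> are the variables with indices \<open>0, \<dots>, N - 1\<close>.
\<close>

type_synonym int_mpoly = "(nat \<Rightarrow>\<^sub>0 nat) \<Rightarrow>\<^sub>0 int"

definition polys_in :: "nat \<Rightarrow> int_mpoly set" where
  "polys_in N = {p. \<forall>m \<in> Poly_Mapping.keys p. Poly_Mapping.keys m \<subseteq> {..<N}}"

definition monom_degree :: "(nat \<Rightarrow>\<^sub>0 nat) \<Rightarrow> nat" where
  "monom_degree m = (\<Sum>i \<in> Poly_Mapping.keys m. Poly_Mapping.lookup m i)"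

definition total_degree :: "int_mpoly \<Rightarrow> ereal" where
  "total_degree p =
    (if p = 0 then - \<infinity> else ereal (real (Max (monom_degree ` Poly_Mapping.keys p))))"

text \<open>
  An \<open>n\<close>-tuple is a function on \<open>{..<n}\<close>, extended by \<^const>\<open>undefined\<close> so that equality of
  functions is equality of tuples.
\<close>

definition poly_tuples :: "nat \<Rightarrow> nat \<Rightarrow> (nat \<Rightarrow> int_mpoly) set" where
  "poly_tuples N n = {..<n} \<rightarrow>\<^sub>E polys_in N"

definition solutions :: "nat \<Rightarrow> nat \<Rightarrow> (nat \<Rightarrow> int_mpoly) \<Rightarrow> (nat \<Rightarrow> int_mpoly) set" where
  "solutions N n f = {y \<in> poly_tuples N n. (\<Sum>i<n. f i * y i) = 0}"

definition generated_module ::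
    "nat \<Rightarrow> nat \<Rightarrow> nat \<Rightarrow> (nat \<Rightarrow> nat \<Rightarrow> int_mpoly) \<Rightarrow> (nat \<Rightarrow> int_mpoly) set" where
  "generated_module N n K y =
    {(\<lambda>i \<in> {..<n}. \<Sum>k<K. a k * y k i) | a. \<forall>k<K. a k \<in> polys_in N}"

end

theory Submission
  imports Defs "Subresultants.More_Homomorphisms"
begin

text \<open>
  Fix \<open>p\<close>, a prime or \<open>0\<close>. By induction on the number of variables, a solution \<open>y\<close> of a linear
  system modulo \<open>p ^ (K + c)\<close>, with \<open>c\<close> depending only on the system, agrees modulo \<open>p ^ K\<close> and up
  to an integer factor prime to \<open>p\<close> with a combination of exact solutions of low degree. Choosing a
  maximal nonvanishing minor with the least power of \<open>p\<close> in its content, Cramer's rule gives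
  low-degree solutions \<open>V j\<close> and some \<open>\<Delta>\<close> nonzero modulo \<open>p\<close> with
  \<open>\<Delta> y = \<Sum>j. y j V j\<close> modulo a power of \<open>p\<close>. After Nagata's change of variables the leading
  coefficient of \<open>\<Delta>\<close> modulo \<open>p\<close> in the last variable is an integer, and Weierstrass division by
  \<open>\<Delta>\<close> modulo \<open>p ^ K\<close> replaces \<open>y\<close> by something of bounded degree in that variable, whose
  coefficients solve a linear system in fewer variables.

  For \<open>p = 0\<close> this says that the module of solutions modulo the submodule \<open>M'\<close> of low-degree
  combinations is torsion. For \<open>p\<close> prime, the statement applied to the matrix of generators of \<open>M'\<close>
  bounds the \<open>p\<close>-power torsion (an Artin-Rees type property), and applied to the original equation
  it shows that every solution lies in \<open>M'\<close> modulo any power of \<open>p\<close>. Hence for every solution \<open>y\<close>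
  the ideal of integers \<open>e\<close> with \<open>e y \<in> M'\<close> lies in no \<open>p\<int>\<close>, so it contains \<open>1\<close>.
\<close>

hide_const (open) module.smult

section \<open>Bounded-degree polynomials and substitution\<close>

text \<open>A natural number bounds the degree and 0 lies in every level, so the levels are additive
  groups and degree \<open>-\<infinity>\<close> needs no case split.\<close>

definition polys_deg_le :: "nat \<Rightarrow> nat \<Rightarrow> int_mpoly set" where
  "polys_deg_le N d =
    {p. \<forall>m \<in> Poly_Mapping.keys p. Poly_Mapping.keys m \<subseteq> {..<N} \<and> monom_degree m \<le> d}"

lemma monom_degree_add: "monom_degree (a + b) = monom_degree a + monom_degree b"
  unfolding monom_degree_def by (rule setsum_keys_plus_distrib) auto

lemma monom_degree_0 [simp]: "monom_degree 0 = 0"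
  by (simp add: monom_degree_def)

lemma keys_add_nat: "Poly_Mapping.keys ((a :: nat \<Rightarrow>\<^sub>0 nat) + b) = Poly_Mapping.keys a \<union> Poly_Mapping.keys b"
  by (auto simp: in_keys_iff lookup_add)

lemma polys_deg_leD: "p \<in> polys_deg_le N d \<Longrightarrow> p \<in> polys_in N"
  by (auto simp: polys_deg_le_def polys_in_def)

lemma polys_deg_le_0 [simp]: "0 \<in> polys_deg_le N d"
  by (simp add: polys_deg_le_def)

lemma polys_deg_le_1 [simp]: "1 \<in> polys_deg_le N d"
  by (simp add: polys_deg_le_def)

lemma of_int_eq_single: "(of_int c :: int_mpoly) = Poly_Mapping.single 0 c"
  using single_of_int[of c, where 'a = "nat \<Rightarrow>\<^sub>0 nat" and 'b = int] by simp

lemma polys_deg_le_of_int [simp]: "of_int c \<in> polys_deg_le N d"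
  unfolding of_int_eq_single by (auto simp: polys_deg_le_def split: if_splits)

lemma polys_deg_le_add: "p \<in> polys_deg_le N d \<Longrightarrow> q \<in> polys_deg_le N d \<Longrightarrow> p + q \<in> polys_deg_le N d"
  using keys_add[of p q] by (auto simp: polys_deg_le_def subset_eq)

lemma polys_deg_le_uminus: "p \<in> polys_deg_le N d \<Longrightarrow> - p \<in> polys_deg_le N d"
  by (simp add: polys_deg_le_def)

lemma polys_deg_le_diff: "p \<in> polys_deg_le N d \<Longrightarrow> q \<in> polys_deg_le N d \<Longrightarrow> p - q \<in> polys_deg_le N d"
  using polys_deg_le_add[of p N d "- q"] polys_deg_le_uminus[of q N d] by simp

lemma polys_deg_le_mult:
  assumes "p \<in> polys_deg_le N a" "q \<in> polys_deg_le N b"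
  shows "p * q \<in> polys_deg_le N (a + b)"
  unfolding polys_deg_le_def
proof (intro CollectI ballI)
  fix m assume "m \<in> Poly_Mapping.keys (p * q)"
  then obtain x y where "m = x + y" "x \<in> Poly_Mapping.keys p" "y \<in> Poly_Mapping.keys q"
    using keys_mult[of p q] by blast
  with assms show "Poly_Mapping.keys m \<subseteq> {..<N} \<and> monom_degree m \<le> a + b"
    by (auto simp: polys_deg_le_def monom_degree_add keys_add_nat intro!: add_mono)
qed

lemma polys_deg_le_mono: "p \<in> polys_deg_le N a \<Longrightarrow> a \<le> b \<Longrightarrow> p \<in> polys_deg_le N b"
  by (fastforce simp: polys_deg_le_def)

lemma polys_deg_le_sum:
  "(\<And>i. i \<in> I \<Longrightarrow> p i \<in> polys_deg_le N d) \<Longrightarrow> sum p I \<in> polys_deg_le N d"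
  by (induction I rule: infinite_finite_induct) (auto intro: polys_deg_le_add)

lemma polys_deg_le_prod:
  "(\<And>i. i \<in> I \<Longrightarrow> p i \<in> polys_deg_le N d) \<Longrightarrow> prod p I \<in> polys_deg_le N (card I * d)"
  by (induction I rule: infinite_finite_induct) (auto intro: polys_deg_le_mult)

lemma polys_deg_le_power:
  "p \<in> polys_deg_le N d \<Longrightarrow> p ^ k \<in> polys_deg_le N (k * d)"
  by (induction k) (auto intro: polys_deg_le_mult)

lemma lookup_of_int_mult:
  "Poly_Mapping.lookup (of_int c * p :: int_mpoly) m = c * Poly_Mapping.lookup p m"
proof -
  have "of_int c * p = Poly_Mapping.map ((*) c) p"
    by (simp only: of_int_eq_single mult_map_scale_conv_mult)
  then show ?thesis by (simp add: map.rep_eq when_def)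
qed

text \<open>Lets a power of \<open>p\<close> be divided out of a minor while its degree bound is
  kept.\<close>

lemma polys_deg_le_of_int_cancel:
  assumes "of_int c * p \<in> polys_deg_le N d" "c \<noteq> 0"
  shows "p \<in> polys_deg_le N d"
  using assms by (auto simp: polys_deg_le_def in_keys_iff lookup_of_int_mult)

text \<open>For \<open>c = 0\<close> both sides say that the polynomial vanishes. Congruences modulo
  0 are thus equalities, which lets the cases \<open>p = 0\<close> and \<open>p\<close> prime share
  one argument.\<close>

lemma of_int_dvd_iff:
  "of_int c dvd (p :: int_mpoly) \<longleftrightarrow> (\<forall>m. c dvd Poly_Mapping.lookup p m)"
proof
  assume "of_int c dvd p" then show "\<forall>m. c dvd Poly_Mapping.lookup p m"
    by (auto simp: dvd_def lookup_of_int_mult)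
next
  assume *: "\<forall>m. c dvd Poly_Mapping.lookup p m"
  define q where "q = Poly_Mapping.map (\<lambda>x. x div c) p"
  have "p = of_int c * q"
    by (rule poly_mapping_eqI)
      (use * in \<open>auto simp: lookup_of_int_mult q_def map.rep_eq when_def\<close>)
  then show "of_int c dvd p" by simp
qed

section \<open>Evaluation homomorphisms\<close>

definition var :: "nat \<Rightarrow> int_mpoly" where
  "var i = frag_of (Poly_Mapping.single i 1)"

lemma var_in: "i < N \<Longrightarrow> 0 < d \<Longrightarrow> var i \<in> polys_deg_le N d"
  by (auto simp: var_def polys_deg_le_def monom_degree_def keys_frag_of)

lemma frag_of_mult: "frag_of a * frag_of b = (frag_of (a + b) :: int_mpoly)"
  by (simp add: mult_single)

text \<open>Integer coefficients have a canonical image in every commutative ring, so the values of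
  the variables alone determine the homomorphism. It serves for the change of variables, its inverse
  and the retraction onto the first \<open>N\<close> variables.\<close>

definition subst :: "(nat \<Rightarrow> 'a :: comm_ring_1) \<Rightarrow> int_mpoly \<Rightarrow> 'a" where
  "subst \<sigma> p = (\<Sum>m \<in> Poly_Mapping.keys p. of_int (Poly_Mapping.lookup p m) *
     (\<Prod>i \<in> Poly_Mapping.keys m. \<sigma> i ^ Poly_Mapping.lookup m i))"

lemma subst_superset:
  assumes "finite S" "Poly_Mapping.keys p \<subseteq> S"
  shows "subst \<sigma> p = (\<Sum>m \<in> S. of_int (Poly_Mapping.lookup p m) *
     (\<Prod>i \<in> Poly_Mapping.keys m. \<sigma> i ^ Poly_Mapping.lookup m i))"
  unfolding subst_def by (rule sum.mono_neutral_left) (use assms in \<open>auto simp: in_keys_iff\<close>)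

lemma subst_add: "subst \<sigma> (p + q) = subst \<sigma> p + subst \<sigma> q"
proof -
  let ?S = "Poly_Mapping.keys p \<union> Poly_Mapping.keys q"
  have "Poly_Mapping.keys (p + q) \<subseteq> ?S" by (rule keys_add)
  then show ?thesis
    by (simp add: subst_superset[of ?S] lookup_add sum.distrib algebra_simps)
qed

lemma subst_frag_of:
  "subst \<sigma> (frag_of m) = (\<Prod>i \<in> Poly_Mapping.keys m. \<sigma> i ^ Poly_Mapping.lookup m i)"
  by (simp add: subst_def keys_frag_of)

lemma subst_0 [simp]: "subst \<sigma> 0 = 0"
  by (simp add: subst_def)

lemma subst_diff: "subst \<sigma> (p - q) = subst \<sigma> p - subst \<sigma> q"
  using subst_add[of \<sigma> "p - q" q] by simp

lemma monom_prod_add: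
  fixes \<sigma> :: "nat \<Rightarrow> 'a :: comm_ring_1"
  shows "(\<Prod>i \<in> Poly_Mapping.keys (a + b). \<sigma> i ^ Poly_Mapping.lookup (a + b) i) =
    (\<Prod>i \<in> Poly_Mapping.keys a. \<sigma> i ^ Poly_Mapping.lookup a i) *
    (\<Prod>i \<in> Poly_Mapping.keys b. \<sigma> i ^ Poly_Mapping.lookup b i)"
proof -
  let ?S = "Poly_Mapping.keys a \<union> Poly_Mapping.keys b"
  have "(\<Prod>i \<in> Poly_Mapping.keys c. \<sigma> i ^ Poly_Mapping.lookup c i) =
      (\<Prod>i \<in> ?S. \<sigma> i ^ Poly_Mapping.lookup c i)" if "Poly_Mapping.keys c \<subseteq> ?S" for c
    by (rule prod.mono_neutral_left) (use that in \<open>auto simp: in_keys_iff\<close>)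
  from this[of a] this[of b] show ?thesis
    by (simp add: keys_add_nat lookup_add power_add prod.distrib)
qed

text \<open>Both sides are biadditive. As an additive group the polynomials are free on the
  monomials, so \<open>frag_induction\<close> leaves only products of two monomials.\<close>

lemma subst_mult: "subst \<sigma> (p * q) = subst \<sigma> p * subst \<sigma> q"
proof (induction p rule: frag_induction[OF subset_UNIV])
  case (2 a)
  show ?case
  proof (induction q rule: frag_induction[OF subset_UNIV])
    case (2 b)
    show ?case by (simp only: frag_of_mult subst_frag_of monom_prod_add)
  next
    case (3 x y)
    then show ?case by (simp add: subst_diff right_diff_distrib)
  qed simp
next
  case (3 x y)
  then show ?case by (simp add: subst_diff left_diff_distrib)
qed simp

lemma subst_1 [simp]: "subst \<sigma> 1 = 1"
  using subst_frag_of[of \<sigma> 0] by simp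

lemma comm_ring_hom_subst: "comm_ring_hom (subst \<sigma>)"
  by unfold_locales (simp_all add: subst_add subst_mult)

lemma subst_var [simp]: "subst \<sigma> (var i) = \<sigma> i"
  by (simp add: var_def subst_frag_of)

lemma subst_cong:
  "(\<And>m i. m \<in> Poly_Mapping.keys p \<Longrightarrow> i \<in> Poly_Mapping.keys m \<Longrightarrow> \<sigma> i = \<tau> i) \<Longrightarrow>
    subst \<sigma> p = subst \<tau> p"
  unfolding subst_def by (intro sum.cong prod.cong refl arg_cong2[of _ _ _ _ "(*)"]) auto

lemma hom_subst:
  assumes "comm_ring_hom h"
  shows "h (subst \<sigma> p) = subst (\<lambda>i. h (\<sigma> i)) p"
proof -
  interpret comm_ring_hom h by fact
  show ?thesis by (simp add: subst_def hom_distribs)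
qed

lemma frag_of_eq_prod_var:
  "(\<Prod>i \<in> Poly_Mapping.keys m. var i ^ Poly_Mapping.lookup m i) = frag_of m"
proof -
  have pw: "var i ^ k = frag_of (Poly_Mapping.single i k)" for i k
    by (induction k) (simp_all add: var_def mult_single flip: single_add)
  have "(\<Prod>i \<in> I. frag_of (Poly_Mapping.single i (Poly_Mapping.lookup m i))) =
      (frag_of (\<Sum>i \<in> I. Poly_Mapping.single i (Poly_Mapping.lookup m i)) :: int_mpoly)" for I
    by (induction I rule: infinite_finite_induct) (auto simp: mult_single)
  moreover have "(\<Sum>i \<in> Poly_Mapping.keys m. Poly_Mapping.single i (Poly_Mapping.lookup m i)) = m"
    by (rule poly_mapping_eqI) (auto simp: lookup_sum lookup_single when_def in_keys_iff)
  ultimately show ?thesis by (simp add: pw)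
qed

lemma subst_var_id: "subst var p = p"
proof (induction p rule: frag_induction[OF subset_UNIV])
  case (2 m)
  show ?case by (simp only: subst_frag_of frag_of_eq_prod_var)
qed (simp_all add: subst_diff)

text \<open>The filtration is instantiated both by the total degree and by the degree in one variable.\<close>

lemma subst_filtration:
  fixes \<sigma> :: "nat \<Rightarrow> 'a :: comm_ring_1" and F :: "nat \<Rightarrow> 'a set"
  assumes p: "p \<in> polys_deg_le N d"
    and \<sigma>: "\<And>i. i < N \<Longrightarrow> \<sigma> i \<in> F 1"
    and of_int: "\<And>c. of_int c \<in> F 0"
    and add: "\<And>k x y. x \<in> F k \<Longrightarrow> y \<in> F k \<Longrightarrow> x + y \<in> F k"
    and mult: "\<And>k l x y. x \<in> F k \<Longrightarrow> y \<in> F l \<Longrightarrow> x * y \<in> F (k + l)"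
    and mono: "\<And>k l x. x \<in> F k \<Longrightarrow> k \<le> l \<Longrightarrow> x \<in> F l"
  shows "subst \<sigma> p \<in> F d"
proof -
  have z: "0 \<in> F k" for k using mono[OF of_int[of 0], of k] by simp
  have o: "1 \<in> F 0" using of_int[of 1] by simp
  have pow: "\<sigma> i ^ k \<in> F k" if "i < N" for i k
    by (induction k) (use o mult[OF \<sigma>[OF that]] in auto)
  have mon: "(\<Prod>i \<in> I. \<sigma> i ^ f i) \<in> F (\<Sum>i \<in> I. f i)" if "I \<subseteq> {..<N}" for I f
    using finite_subset[OF that finite_lessThan] that
    by (induction I rule: finite_induct) (auto intro!: o mult pow)
  have sums: "(\<Sum>m \<in> S. g m) \<in> F d" if "\<And>m. m \<in> S \<Longrightarrow> g m \<in> F d"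
    for S :: "(nat \<Rightarrow>\<^sub>0 nat) set" and g
    using that by (induction S rule: infinite_finite_induct) (auto intro: z add)
  show ?thesis unfolding subst_def
  proof (rule sums)
    fix m assume "m \<in> Poly_Mapping.keys p"
    with p have m: "Poly_Mapping.keys m \<subseteq> {..<N}" "monom_degree m \<le> d"
      by (auto simp: polys_deg_le_def)
    from mult[OF of_int mon[OF m(1), of "Poly_Mapping.lookup m"]] m(2)
    show "of_int (Poly_Mapping.lookup p m) *
        (\<Prod>i \<in> Poly_Mapping.keys m. \<sigma> i ^ Poly_Mapping.lookup m i) \<in> F d"
      by (auto intro: mono simp: monom_degree_def)
  qed
qed

section \<open>Cramer relations\<close>

lemma det_polys_deg_le:
  assumes M: "M \<in> carrier_mat r r"
    and entries: "\<And>i j. i < r \<Longrightarrow> j < r \<Longrightarrow> M $$ (i, j) \<in> polys_deg_le N d"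
  shows "det M \<in> polys_deg_le N (r * d)"
  unfolding det_def'[OF M]
proof (rule polys_deg_le_sum)
  fix \<pi> assume "\<pi> \<in> {\<pi>. \<pi> permutes {0..<r}}"
  then have \<pi>: "\<pi> i < r" if "i < r" for i
    using that permutes_in_image[of \<pi> "{0..<r}" i] by simp
  have "(\<Prod>i = 0..<r. M $$ (i, \<pi> i)) \<in> polys_deg_le N (card {0..<r} * d)"
    by (rule polys_deg_le_prod) (auto intro: entries \<pi>)
  then show "signof \<pi> * (\<Prod>i = 0..<r. M $$ (i, \<pi> i)) \<in> polys_deg_le N (r * d)"
    using polys_deg_le_mult[OF polys_deg_le_of_int[of "sign \<pi>" N 0]] by fastforce
qed

text \<open>The selections \<open>f\<close> and \<open>g\<close> need be neither increasing nor
  injective. Exchanging a column is therefore the update \<open>g(c := j)\<close>, and a repeated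
  index gives 0.\<close>

definition minor :: "(nat \<Rightarrow> nat \<Rightarrow> 'a :: comm_ring_1) \<Rightarrow> nat \<Rightarrow> (nat \<Rightarrow> nat) \<Rightarrow> (nat \<Rightarrow> nat) \<Rightarrow> 'a" where
  "minor A r f g = det (mat r r (\<lambda>(a, b). A (f a) (g b)))"

text \<open>The cofactors along column \<open>c\<close> do not depend on that column, so the same
  coefficients serve for every \<open>j\<close>. This is the form in which Cramer's rule is
  applied.\<close>

lemma minor_replace_column:
  fixes A :: "nat \<Rightarrow> nat \<Rightarrow> 'a :: comm_ring_1"
  assumes "c < r"
  shows "minor A r f (g(c := j)) =
    (\<Sum>a<r. A (f a) j * cofactor (mat r r (\<lambda>(a, b). A (f a) (g b))) a c)"
proof -
  let ?M = "mat r r (\<lambda>(a, b). A (f a) ((g(c := j)) b))"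
  have "mat_delete ?M a c = mat_delete (mat r r (\<lambda>(a, b). A (f a) (g b))) a c" for a
    by (rule eq_matI) (auto simp: mat_delete_def)
  then have "cofactor ?M a c = cofactor (mat r r (\<lambda>(a, b). A (f a) (g b))) a c" for a
    by (simp add: cofactor_def)
  moreover have "det ?M = (\<Sum>a<r. ?M $$ (a, c) * cofactor ?M a c)"
    by (rule laplace_expansion_column[OF _ assms]) simp
  ultimately show ?thesis using assms unfolding minor_def by simp
qed

lemma minor_replace_column_self:
  fixes A :: "nat \<Rightarrow> nat \<Rightarrow> 'a :: comm_ring_1"
  assumes "c < r" "b < r"
  shows "minor A r f (g(c := g b)) = (if c = b then minor A r f g else 0)"
proof (cases "c = b")
  case False
  have "minor A r f (g(c := g b)) = 0" unfolding minor_def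
    by (rule det_identical_columns[OF _ False]) (use assms False in \<open>auto intro!: eq_vecI\<close>)
  with False show ?thesis by simp
qed simp

text \<open>The singular bordered matrix has a nonzero kernel vector \<open>v\<close>. By Cramer's
  rule its first \<open>r\<close> rows express the nonzero minor times \<open>v $ c\<close> as a
  multiple of \<open>v $ r\<close>. Hence \<open>v $ r\<close> is nonzero, and it cancels from the
  last row.\<close>

lemma bordered_minor:
  fixes A :: "nat \<Rightarrow> nat \<Rightarrow> 'a :: idom"
  assumes nz: "minor A r f g \<noteq> 0" and border: "minor A (Suc r) (f(r := k)) (g(r := j)) = 0"
  shows "A k j * minor A r f g = (\<Sum>c<r. A k (g c) * minor A r f (g(c := j)))"
proof -
  let ?M = "mat (Suc r) (Suc r) (\<lambda>(a, b). A ((f(r := k)) a) ((g(r := j)) b))"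
  obtain v where v: "v \<in> carrier_vec (Suc r)" "v \<noteq> 0\<^sub>v (Suc r)" "?M *\<^sub>v v = 0\<^sub>v (Suc r)"
    using det_0_iff_vec_prod_zero[of ?M "Suc r"] border by (auto simp: minor_def)
  have row: "(\<Sum>b<Suc r. A ((f(r := k)) a) ((g(r := j)) b) * v $ b) = 0" if "a < Suc r" for a
  proof -
    have "(?M *\<^sub>v v) $ a = 0" using that v(3) by simp
    then show ?thesis using that v(1)
      by (simp add: scalar_prod_def atLeast0LessThan del: sum.lessThan_Suc)
  qed
  have rowf: "(\<Sum>b<r. A (f a) (g b) * v $ b) = - A (f a) j * v $ r" if "a < r" for a
    using row[of a] that by (simp add: eq_neg_iff_add_eq_0)
  have rowk: "(\<Sum>b<r. A k (g b) * v $ b) + A k j * v $ r = 0"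
    using row[of r] by simp
  define cf where "cf a c = cofactor (mat r r (\<lambda>(a, b). A (f a) (g b))) a c" for a c
  have cramer: "minor A r f g * v $ c = - minor A r f (g(c := j)) * v $ r" if "c < r" for c
  proof -
    have "minor A r f g * v $ c = (\<Sum>b<r. minor A r f (g(c := g b)) * v $ b)"
      using that by (simp add: minor_replace_column_self if_distrib[of "\<lambda>x. x * _"] cong: if_cong)
    also have "\<dots> = (\<Sum>b<r. \<Sum>a<r. cf a c * (A (f a) (g b) * v $ b))"
      using that by (simp add: minor_replace_column cf_def sum_distrib_left mult_ac)
    also have "\<dots> = (\<Sum>a<r. cf a c * (\<Sum>b<r. A (f a) (g b) * v $ b))"
      by (subst sum.swap) (simp add: sum_distrib_left)
    also have "\<dots> = (\<Sum>a<r. cf a c * (- A (f a) j * v $ r))"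
      by (intro sum.cong refl) (simp add: rowf)
    also have "\<dots> = - minor A r f (g(c := j)) * v $ r"
      using that by (simp add: minor_replace_column cf_def sum_distrib_left mult_ac sum_negf)
    finally show ?thesis .
  qed
  have "v $ r \<noteq> 0"
  proof
    assume "v $ r = 0"
    with cramer nz have "v $ c = 0" if "c < r" for c using that by simp
    with \<open>v $ r = 0\<close> have "v = 0\<^sub>v (Suc r)"
      using v(1) by (intro eq_vecI) (auto simp: less_Suc_eq)
    with v(2) show False by contradiction
  qed
  have "0 = minor A r f g * ((\<Sum>b<r. A k (g b) * v $ b) + A k j * v $ r)"
    by (simp add: rowk)
  also have "\<dots> = (\<Sum>b<r. A k (g b) * (minor A r f g * v $ b)) + minor A r f g * A k j * v $ r"
    by (simp add: distrib_left sum_distrib_left mult_ac)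
  also have "(\<Sum>b<r. A k (g b) * (minor A r f g * v $ b)) =
      (\<Sum>b<r. A k (g b) * (- minor A r f (g(b := j)) * v $ r))"
    by (intro sum.cong refl) (simp only: cramer lessThan_iff)
  also have "\<dots> = - (\<Sum>b<r. A k (g b) * minor A r f (g(b := j))) * v $ r"
    by (simp add: sum_distrib_left sum_negf mult_ac)
  finally have "(A k j * minor A r f g - (\<Sum>b<r. A k (g b) * minor A r f (g(b := j)))) * v $ r = 0"
    by (simp add: left_diff_distrib mult.commute)
  with \<open>v $ r \<noteq> 0\<close> show ?thesis by simp
qed

text \<open>Exponent 1 works for \<open>p = 0\<close>. For a prime, any nonzero coefficient
  \<open>c\<close> has absolute value below \<open>p ^ nat \<bar>c\<bar>\<close>.\<close>

lemma power_not_dvd: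
  fixes a :: int_mpoly
  assumes p: "p = 0 \<or> prime (p :: int)" and "a \<noteq> 0"
  shows "\<exists>v. \<not> of_int (p ^ v) dvd a"
  using p
proof
  assume "p = 0"
  with \<open>a \<noteq> 0\<close> have "\<not> of_int (p ^ 1) dvd a" by simp
  then show ?thesis by blast
next
  assume p: "prime p"
  from \<open>a \<noteq> 0\<close> obtain m where m: "Poly_Mapping.lookup a m \<noteq> 0"
    by (metis poly_mapping_eqI lookup_zero)
  let ?c = "Poly_Mapping.lookup a m"
  have "\<not> p ^ nat \<bar>?c\<bar> dvd ?c"
  proof
    assume "p ^ nat \<bar>?c\<bar> dvd ?c"
    then have "p ^ nat \<bar>?c\<bar> \<le> \<bar>?c\<bar>" using m by (auto intro: dvd_imp_le_int order_trans[OF abs_ge_self])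
    moreover have "(2 :: int) ^ nat \<bar>?c\<bar> \<le> p ^ nat \<bar>?c\<bar>"
      using prime_ge_2_int[OF p] by (intro power_mono) auto
    moreover have "int (nat \<bar>?c\<bar>) < 2 ^ nat \<bar>?c\<bar>" by (rule of_nat_less_two_power)
    ultimately show False by simp
  qed
  then show ?thesis unfolding of_int_dvd_iff by blast
qed

text \<open>Take a nonvanishing minor of maximal size \<open>r\<close> with the least power
  \<open>p ^ v\<close> in its content, and divide by \<open>p ^ v\<close> to get
  \<open>\<Delta>\<close>. The minors with one column exchanged, divided by the same
  \<open>p ^ v\<close>, give the entries of Cramer's solutions \<open>K j\<close>. These are exact
  because the minors of size \<open>r + 1\<close> vanish. For approximate solutions the division by
  \<open>p ^ v\<close> is the only loss of precision.\<close>

lemma minor_relations: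
  fixes A :: "nat \<Rightarrow> nat \<Rightarrow> int_mpoly" and p :: int
  assumes p: "p = 0 \<or> prime p"
    and A: "\<And>i j. i < m \<Longrightarrow> j < n \<Longrightarrow> A i j \<in> polys_deg_le N d"
  obtains \<Delta> K v where
    "\<Delta> \<in> polys_deg_le N (m * d)" "\<not> of_int p dvd \<Delta>"
    "\<forall>i<n. \<forall>j<n. K j i \<in> polys_deg_le N (m * d)"
    "\<forall>k<m. \<forall>j<n. (\<Sum>i<n. A k i * K j i) = 0"
    "\<forall>q y. (\<forall>k<m. of_int (p ^ v * q) dvd (\<Sum>j<n. A k j * y j)) \<longrightarrow>
      (\<forall>i<n. of_int q dvd \<Delta> * y i - (\<Sum>j<n. y j * K j i))"
proof -
  define valid where "valid r f g \<longleftrightarrow> (\<forall>a<r. f a < m \<and> g a < n)" for r and f g :: "nat \<Rightarrow> nat"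
  define NZ where "NZ r \<longleftrightarrow> (\<exists>f g. valid r f g \<and> minor A r f g \<noteq> 0)" for r
  have P0: "NZ 0" by (auto simp: NZ_def valid_def minor_def)
  have Pm: "r \<le> m" if "NZ r" for r
  proof (rule ccontr)
    assume "\<not> r \<le> m"
    from that obtain f g where fg: "valid r f g" "minor A r f g \<noteq> 0" by (auto simp: NZ_def)
    have "\<not> inj_on f {..<r}"
    proof
      assume "inj_on f {..<r}"
      then have "card {..<r} \<le> card {..<m}"
        by (rule card_inj_on_le) (use fg in \<open>auto simp: valid_def\<close>)
      with \<open>\<not> r \<le> m\<close> show False by simp
    qed
    then obtain a b where ab: "a < r" "b < r" "a \<noteq> b" "f a = f b" by (auto simp: inj_on_def)
    have "minor A r f g = 0" unfolding minor_def
      by (rule det_identical_rows[OF _ ab(3,1,2)]) (use ab in \<open>auto intro!: eq_vecI\<close>)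
    with fg show False by simp
  qed
  define r where "r = (GREATEST r. NZ r)"
  have Pr: "NZ r" unfolding r_def by (rule GreatestI_nat[where P = NZ and b = m, OF P0 Pm])
  have "\<not> NZ (Suc r)" using Greatest_le_nat[of NZ "Suc r" m] Pm by (auto simp: r_def)
  have "r \<le> m" using Pm Pr .
  \<comment> \<open>The exponent \<open>v\<close> extracted below is the largest one such that
    \<open>p ^ v\<close> divides all \<open>r\<close>-minors. For \<open>p = 0\<close> it is 0, so
    that \<open>P = 1\<close>.\<close>
  define Q where "Q v \<longleftrightarrow> (\<forall>f g. valid r f g \<longrightarrow> of_int (p ^ v) dvd minor A r f g)" for v
  from Pr power_not_dvd[OF p] have "\<exists>v. \<not> Q v" unfolding NZ_def Q_def by blast
  then obtain v' where v': "\<not> Q v'" "\<And>u. u < v' \<Longrightarrow> Q u"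
    using exists_least_iff[of "\<lambda>v. \<not> Q v"] by blast
  have "Q 0" by (simp add: Q_def)
  with v'(1) obtain v where "v' = Suc v" by (cases v') auto
  with v' have Qv: "Q v" and "\<not> Q (Suc v)" by auto
  then obtain f g where fg: "valid r f g" "\<not> of_int (p ^ Suc v) dvd minor A r f g"
    unfolding Q_def by blast
  then have nz: "minor A r f g \<noteq> 0" by auto
  define P where "P = p ^ v"
  from Qv fg obtain \<Delta> where \<Delta>: "minor A r f g = of_int P * \<Delta>"
    by (auto simp: Q_def P_def elim!: dvdE)
  with nz have "P \<noteq> 0" by auto
  have valid': "valid r f (g(c := j))" if "j < n" for c j
    using fg that by (auto simp: valid_def)
  have "\<forall>c j. \<exists>x. j < n \<longrightarrow> minor A r f (g(c := j)) = of_int P * x"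
    using Qv valid' unfolding Q_def P_def dvd_def by meson
  then obtain X where X: "\<And>c j. j < n \<Longrightarrow> minor A r f (g(c := j)) = of_int P * X c j"
    by metis
  have deg: "x \<in> polys_deg_le N (m * d)" if "minor A r f g = of_int P * x" "valid r f g" for x f g
  proof (rule polys_deg_le_of_int_cancel[OF _ \<open>P \<noteq> 0\<close>])
    have "minor A r f g \<in> polys_deg_le N (r * d)" unfolding minor_def
      by (rule det_polys_deg_le) (use that(2) A in \<open>auto simp: valid_def\<close>)
    then show "of_int P * x \<in> polys_deg_le N (m * d)"
      using that(1) \<open>r \<le> m\<close> by (auto intro: polys_deg_le_mono)
  qed
  \<comment> \<open>Cramer's solution with \<open>j\<close> as free unknown: \<open>\<Delta>\<close>
    at \<open>j\<close> and \<open>- X c j\<close> at the pivot position \<open>g c\<close>. If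
    \<open>j\<close> is itself a pivot, the terms cancel and the tuple is 0.\<close>
  define K where "K j i = (if i = j then \<Delta> else 0) - (\<Sum>c<r. if g c = i then X c j else 0)" for j i
  have sumK: "(\<Sum>i<n. z i * K j i) = z j * \<Delta> - (\<Sum>c<r. z (g c) * X c j)" if "j < n" for z j
  proof -
    have "(\<Sum>i<n. z i * (\<Sum>c<r. if g c = i then X c j else 0)) =
        (\<Sum>c<r. \<Sum>i<n. if g c = i then z i * X c j else 0)"
      unfolding sum_distrib_left by (subst sum.swap) (auto intro!: sum.cong)
    also have "\<dots> = (\<Sum>c<r. z (g c) * X c j)"
      using fg(1) by (intro sum.cong refl) (auto simp: valid_def)
    moreover have "(\<Sum>i<n. z i * (if i = j then \<Delta> else 0)) = z j * \<Delta>"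
      using that by (simp add: if_distrib[of "\<lambda>x. _ * x"] cong: if_cong)
    ultimately show ?thesis by (simp add: K_def right_diff_distrib sum_subtractf)
  qed
  show thesis
  proof (rule that[of \<Delta> K v])
    show "\<Delta> \<in> polys_deg_le N (m * d)" using \<Delta> fg(1) by (rule deg)
    show "\<not> of_int p dvd \<Delta>"
    proof
      assume "of_int p dvd \<Delta>"
      then have "of_int P * of_int p dvd of_int P * \<Delta>" by (rule mult_dvd_mono[OF dvd_refl])
      with fg(2) show False by (simp add: \<Delta> P_def mult.commute)
    qed
    have "K j i \<in> polys_deg_le N (m * d)" if "i < n" "j < n" for i j
      unfolding K_def using deg[OF \<Delta> fg(1)] deg[OF X[OF that(2)] valid'[OF that(2)]]
      by (intro polys_deg_le_diff polys_deg_le_sum) auto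
    then show "\<forall>i<n. \<forall>j<n. K j i \<in> polys_deg_le N (m * d)" by blast
    have "(\<Sum>i<n. A k i * K j i) = 0" if "k < m" "j < n" for k j
    proof -
      have "valid (Suc r) (f(r := k)) (g(r := j))"
        using fg(1) that by (auto simp: valid_def less_Suc_eq)
      with \<open>\<not> NZ (Suc r)\<close> have "minor A (Suc r) (f(r := k)) (g(r := j)) = 0"
        by (auto simp: NZ_def)
      from bordered_minor[OF nz this]
      have "of_int P * (A k j * \<Delta>) = of_int P * (\<Sum>c<r. A k (g c) * X c j)"
        using that(2) by (simp add: \<Delta> X sum_distrib_left mult_ac)
      with \<open>P \<noteq> 0\<close> show ?thesis by (simp add: sumK[OF that(2)])
    qed
    then show "\<forall>k<m. \<forall>j<n. (\<Sum>i<n. A k i * K j i) = 0" by blast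
    have "of_int q dvd \<Delta> * y i - (\<Sum>j<n. y j * K j i)"
      if *: "\<And>k. k < m \<Longrightarrow> of_int (p ^ v * q) dvd (\<Sum>j<n. A k j * y j)" and "i < n" for q y i
    proof -
      define S where "S c = (\<Sum>j<n. y j * X c j)" for c
      have S: "of_int q dvd S c" if "c < r" for c
      proof -
        \<comment> \<open>The cofactors combine the rows \<open>f a\<close> of the system into
          \<open>P * S c\<close>; cancelling \<open>P\<close> from the divisor \<open>P * q\<close>
          leaves \<open>q\<close>.\<close>
        define cf where "cf a = cofactor (mat r r (\<lambda>(a, b). A (f a) (g b))) a c" for a
        have "of_int P * S c = (\<Sum>j<n. y j * minor A r f (g(c := j)))"
          by (simp add: S_def X sum_distrib_left mult_ac)
        also have "\<dots> = (\<Sum>j<n. \<Sum>a<r. cf a * (A (f a) j * y j))"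
          using that by (simp add: minor_replace_column cf_def sum_distrib_left mult_ac)
        also have "\<dots> = (\<Sum>a<r. cf a * (\<Sum>j<n. A (f a) j * y j))"
          by (subst sum.swap) (simp add: sum_distrib_left)
        finally have eq: "of_int P * S c = (\<Sum>a<r. cf a * (\<Sum>j<n. A (f a) j * y j))" .
        have "of_int (P * q) dvd (\<Sum>a<r. cf a * (\<Sum>j<n. A (f a) j * y j))"
          unfolding P_def
          by (intro dvd_sum dvd_mult *) (use fg(1) in \<open>auto simp: valid_def\<close>)
        then have "of_int (P * q) dvd of_int P * S c" by (simp only: eq)
        with \<open>P \<noteq> 0\<close> show ?thesis by simp
      qed
      have "(\<Sum>j<n. y j * K j i) = \<Delta> * y i - (\<Sum>c<r. if g c = i then S c else 0)"
      proof -
        have "(\<Sum>j<n. y j * (\<Sum>c<r. if g c = i then X c j else 0)) =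
            (\<Sum>c<r. \<Sum>j<n. if g c = i then y j * X c j else 0)"
          unfolding sum_distrib_left by (subst sum.swap) (auto intro!: sum.cong)
        also have "\<dots> = (\<Sum>c<r. if g c = i then S c else 0)"
          by (auto simp: S_def intro!: sum.cong)
        moreover have "(\<Sum>j<n. y j * (if i = j then \<Delta> else 0)) = \<Delta> * y i"
          using \<open>i < n\<close> by (simp add: if_distrib[of "\<lambda>x. _ * x"] cong: if_cong)
        ultimately show ?thesis by (simp add: K_def right_diff_distrib sum_subtractf)
      qed
      then show ?thesis using S by (auto intro!: dvd_sum)
    qed
    then show "\<forall>q y. (\<forall>k<m. of_int (p ^ v * q) dvd (\<Sum>j<n. A k j * y j)) \<longrightarrow>
      (\<forall>i<n. of_int q dvd \<Delta> * y i - (\<Sum>j<n. y j * K j i))" by blast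
  qed
qed

section \<open>Weierstrass division modulo prime powers\<close>

lemma of_int_dvd_poly_iff:
  "of_int c dvd (P :: int_mpoly poly) \<longleftrightarrow> (\<forall>t. of_int c dvd coeff P t)"
  by (simp add: of_int_poly const_poly_dvd_iff)

lemma poly_cutoff_cong:
  fixes P :: "int_mpoly poly"
  assumes "\<And>t. t \<ge> E \<Longrightarrow> of_int c dvd coeff P t"
  shows "of_int c dvd P - poly_cutoff E P"
  using assms by (auto simp: of_int_dvd_poly_iff coeff_poly_cutoff)

text \<open>Let \<open>t \<ge> E\<close> be the largest index at which divisibility fails. Modulo
  \<open>p ^ K\<close> the coefficient of \<open>w * P\<close> at \<open>s + t\<close> is then
  \<open>b * coeff P t\<close>, and \<open>b\<close> cancels: it is prime to \<open>p\<close>, or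
  nonzero if \<open>p = 0\<close>. \<open>K > 0\<close> matters because
  \<open>0 ^ 0 = 1\<close>.\<close>

lemma coprime_lead_cancel:
  fixes w P :: "int_mpoly poly" and p :: int
  assumes p: "p = 0 \<or> prime p" and K: "K > 0"
    and w: "degree w \<le> s" "coeff w s = of_int b" "\<not> p dvd b"
    and high: "\<And>t. t \<ge> s + E \<Longrightarrow> of_int (p ^ K) dvd coeff (w * P) t"
    and t: "t \<ge> E"
  shows "of_int (p ^ K) dvd coeff P t"
proof -
  have bc: "of_int (p ^ K) dvd x" if "of_int (p ^ K) dvd of_int b * x" for x :: int_mpoly
  proof (cases "p = 0")
    case True
    with that K w(3) show ?thesis by (auto simp: zero_power)
  next
    case False
    with p have "prime p" by simp
    with w(3) have "coprime (p ^ K) b" by (simp add: prime_imp_coprime)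
    with that show ?thesis
      by (simp add: of_int_dvd_iff lookup_of_int_mult coprime_dvd_mult_right_iff del: of_int_power)
  qed
  have "\<forall>t. E \<le> t \<longrightarrow> of_int (p ^ K) dvd coeff P t"
  proof (rule ccontr)
    assume "\<not> ?thesis"
    then obtain t0 where t0: "E \<le> t0" "\<not> of_int (p ^ K) dvd coeff P t0" by blast
    define B where "B t \<longleftrightarrow> E \<le> t \<and> \<not> of_int (p ^ K) dvd coeff P t" for t
    have bound: "t \<le> degree P" if "B t" for t
      using that by (intro le_degree) (auto simp: B_def)
    define t where "t = (GREATEST t. B t)"
    have B: "B t" unfolding t_def
      by (rule GreatestI_nat[where P = B and b = "degree P" and k = t0]) (use t0 bound in \<open>auto simp: B_def\<close>)
    have gr: "of_int (p ^ K) dvd coeff P u" if "u > t" for u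
    proof (rule ccontr)
      assume "\<not> ?thesis"
      with that B have "B u" by (simp add: B_def)
      then have "u \<le> t" unfolding t_def by (rule Greatest_le_nat[where b = "degree P"]) (rule bound)
      with that show False by simp
    qed
    have "coeff (w * P) (s + t) = (\<Sum>i\<le>s + t. coeff w i * coeff P (s + t - i))"
      by (simp add: coeff_mult)
    also have "\<dots> = coeff w s * coeff P t + (\<Sum>i\<in>{..s + t} - {s}. coeff w i * coeff P (s + t - i))"
      by (subst sum.remove[of _ s]) auto
    finally have eq: "coeff (w * P) (s + t) =
      of_int b * coeff P t + (\<Sum>i\<in>{..s + t} - {s}. coeff w i * coeff P (s + t - i))" by (simp add: w)
    have "of_int (p ^ K) dvd (\<Sum>i\<in>{..s + t} - {s}. coeff w i * coeff P (s + t - i))"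
    proof (rule dvd_sum)
      fix i assume i: "i \<in> {..s + t} - {s}"
      show "of_int (p ^ K) dvd coeff w i * coeff P (s + t - i)"
      proof (cases "i < s")
        case True
        then show ?thesis by (intro dvd_mult gr) simp
      next
        case False
        with i w(1) have "coeff w i = 0" by (intro coeff_eq_0) auto
        then show ?thesis by simp
      qed
    qed
    moreover have "of_int (p ^ K) dvd coeff (w * P) (s + t)" using B by (intro high) (simp add: B_def)
    ultimately have "of_int (p ^ K) dvd of_int b * coeff P t" unfolding eq
      by (simp only: dvd_add_left_iff)
    from bc[OF this] B show False by (simp add: B_def)
  qed
  with t show ?thesis by blast
qed

text \<open>The remainder is bounded through its coefficients, since a degree below \<open>s\<close>
  is impossible for \<open>s = 0\<close>.\<close>

lemma pseudo_division:
  fixes w y :: "'a :: idom poly"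
  assumes "degree w = s" "w \<noteq> 0"
  obtains l q r where "smult (coeff w s ^ l) y = w * q + r" "\<And>t. t \<ge> s \<Longrightarrow> coeff r t = 0"
proof -
  obtain q r where qr: "pseudo_divmod y w = (q, r)" by force
  from pseudo_divmod[OF assms(2) qr] assms(1) show thesis
    by (intro that[of "Suc (degree y) - s" q r]) (auto intro: coeff_eq_0)
qed

text \<open>Weierstrass preparation by Hensel lifting. If the error is \<open>P * h\<close> with
  \<open>P = p ^ Suc k\<close>, divide \<open>h = w * q + r\<close> by the monic \<open>w\<close>,
  then add \<open>P * q\<close> to \<open>u\<close> and \<open>P * r\<close> to \<open>w\<close>.
  The new error \<open>P * ((1 - u) * r - P * q * r)\<close> gains a factor \<open>p\<close> because
  \<open>u\<close> is 1 modulo \<open>p\<close>, and the low degree of \<open>r\<close> keeps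
  \<open>w\<close> monic of degree \<open>s\<close>.\<close>

lemma weierstrass_prime:
  fixes \<Delta> :: "int_mpoly poly" and p :: int
  assumes lead: "of_int p dvd coeff \<Delta> s - 1"
    and high: "\<And>t. t > s \<Longrightarrow> of_int p dvd coeff \<Delta> t"
  shows "\<exists>u w. degree w = s \<and> coeff w s = 1 \<and> of_int p dvd u - 1 \<and>
    of_int (p ^ Suc k) dvd \<Delta> - u * w"
proof (induction k)
  case 0
  define w where "w = poly_cutoff s \<Delta> + monom 1 s"
  have cw: "coeff w t = (if t < s then coeff \<Delta> t else if t = s then 1 else 0)" for t
    by (auto simp: w_def coeff_poly_cutoff)
  have "degree w = s"
    by (rule antisym) (auto intro!: degree_le le_degree simp: cw)
  moreover have "of_int p dvd \<Delta> - w"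
    using lead high by (auto simp: of_int_dvd_poly_iff cw)
  ultimately show ?case by (intro exI[of _ 1] exI[of _ w]) (simp add: cw)
next
  case (Suc k)
  then obtain u w where uw: "degree w = s" "coeff w s = 1" "of_int p dvd u - 1"
    "of_int (p ^ Suc k) dvd \<Delta> - u * w" by blast
  define P where "P = (of_int (p ^ Suc k) :: int_mpoly poly)"
  from uw(4) obtain h where h: "\<Delta> - u * w = P * h" by (auto simp: P_def elim: dvdE)
  from uw(3) obtain g where g: "u - 1 = of_int p * g" by (auto elim: dvdE)
  have "w \<noteq> 0" using uw by auto
  from pseudo_division[OF uw(1) this, of h] obtain q r
    where qr: "h = w * q + r" and r: "\<And>t. t \<ge> s \<Longrightarrow> coeff r t = 0"
    using uw(2) by auto
  have coP: "coeff (P * r) t = of_int (p ^ Suc k) * coeff r t" for t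
    by (simp add: P_def of_int_poly del: of_int_power)
  let ?u = "u + P * q" and ?w = "w + P * r"
  have c: "coeff ?w s = 1" using uw(2) r by (simp add: coP)
  have "degree ?w = s"
  proof (rule antisym)
    show "degree ?w \<le> s"
      by (rule degree_le) (use uw(1) r in \<open>auto simp: coP coeff_eq_0\<close>)
    show "s \<le> degree ?w" by (rule le_degree) (simp only: c, simp)
  qed
  moreover have "of_int p dvd ?u - 1"
  proof -
    have "?u - 1 = of_int p * (g + of_int (p ^ k) * q)"
      using g by (simp add: P_def algebra_simps)
    then show ?thesis by simp
  qed
  moreover have "of_int (p ^ Suc (Suc k)) dvd \<Delta> - ?u * ?w"
  proof -
    have "u = 1 + of_int p * g" using g by (simp add: algebra_simps)
    have "\<Delta> - ?u * ?w = P * h - P * (u * r + q * w + P * q * r)"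
      using h by (simp add: algebra_simps)
    also have "\<dots> = P * ((1 - u) * r - P * q * r)"
      by (simp add: qr algebra_simps)
    also have "\<dots> = (of_int p * P) * (- g * r - of_int (p ^ k) * q * r)"
      using g unfolding \<open>u = _\<close> by (simp add: P_def algebra_simps)
    finally show ?thesis by (simp add: P_def)
  qed
  ultimately show ?case using c by blast
qed

text \<open>For \<open>p = 0\<close> the polynomial \<open>\<Delta>\<close> has leading coefficient
  \<open>c\<close> and is its own \<open>w\<close>. For a prime, an inverse \<open>e\<close> of
  \<open>c\<close> modulo \<open>p\<close> normalizes the leading coefficient to 1 modulo
  \<open>p\<close>, and preparation applies.\<close>

lemma weierstrass_factor:
  fixes \<Delta> :: "int_mpoly poly" and p :: int
  assumes p: "p = 0 \<or> prime p" and K: "K > 0"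
    and lead: "of_int p dvd coeff \<Delta> s - of_int c" "\<not> p dvd c"
    and high: "\<And>t. t > s \<Longrightarrow> of_int p dvd coeff \<Delta> t"
  obtains u u' w b e where "degree w = s" "coeff w s = of_int b" "\<not> p dvd b"
    "of_int (p ^ K) dvd of_int e * \<Delta> - u * w" "of_int (p ^ K) dvd u * u' - 1"
proof (cases "p = 0")
  case True
  have c: "coeff \<Delta> s = of_int c" using lead True by simp
  have "degree \<Delta> = s"
    by (rule antisym) (use high lead c True in \<open>auto intro!: degree_le le_degree\<close>)
  then show thesis using c lead(2) by (intro that[of \<Delta> c 1 1 1]) auto
next
  case False
  with p have "prime p" by simp
  with lead(2) have "coprime c p" using prime_imp_coprime coprime_commute by blast
  then obtain e z' where "e * c + z' * p = 1" using bezout_int[of c p] by auto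
  then obtain z where z: "c * e = 1 + p * z" by (intro that[of "- z'"]) (simp add: algebra_simps)
  obtain k where k: "K = Suc k" using K by (cases K) auto
  have coe: "coeff (of_int e * \<Delta>) t = of_int e * coeff \<Delta> t" for t
    by (simp add: of_int_poly)
  have "of_int p dvd coeff (of_int e * \<Delta>) s - 1"
  proof -
    have "coeff (of_int e * \<Delta>) s - 1 =
        of_int e * (coeff \<Delta> s - of_int c) + (of_int (c * e) - 1)"
      unfolding coe by (simp add: algebra_simps)
    also have "of_int (c * e) - 1 = of_int p * (of_int z :: int_mpoly)" by (simp add: z)
    finally show ?thesis using lead(1) by simp
  qed
  moreover have "of_int p dvd coeff (of_int e * \<Delta>) t" if "t > s" for t
    using high[OF that] by (simp add: coe)
  ultimately obtain u w where uw: "degree w = s" "coeff w s = 1" "of_int p dvd u - 1"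
    "of_int (p ^ K) dvd of_int e * \<Delta> - u * w"
    using weierstrass_prime[of p "of_int e * \<Delta>" s k] k by blast
  from uw(3) obtain g' where g': "u - 1 = of_int p * g'" by (elim dvdE)
  define g where "g = - g'"
  have g: "1 - u = of_int p * g" using g' by (simp add: g_def algebra_simps)
  \<comment> \<open>\<open>x\<close> is divisible by \<open>p\<close>, so the geometric series of
    length \<open>K\<close> inverts \<open>u = 1 - x\<close> modulo \<open>p ^ K\<close>.\<close>
  define x where "x = 1 - u"
  have "u * (\<Sum>i<K. x ^ i) - 1 = (1 - x) * (\<Sum>i<K. x ^ i) - 1" by (simp add: x_def)
  also have "\<dots> = - (x ^ K)" by (simp only: one_diff_power_eq[symmetric]) simp
  also have "of_int (p ^ K) dvd \<dots>" by (simp add: x_def g power_mult_distrib)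
  finally have inv: "of_int (p ^ K) dvd u * (\<Sum>i<K. x ^ i) - 1" .
  have "\<not> p dvd 1" using \<open>prime p\<close> not_prime_unit by blast
  with uw(1,2,4) inv show thesis by (intro that[of w 1 e u]) simp_all
qed

text \<open>Dividing each \<open>u' * Y j\<close> by \<open>w\<close> makes
  \<open>b ^ L * Y j\<close> congruent to \<open>\<Delta> * Q j + u * R j\<close> with
  \<open>R j\<close> of degree below \<open>s\<close>. After subtracting the multiples
  \<open>Q j\<close> of \<open>V j\<close>, the hypothesis on \<open>Y\<close> makes
  \<open>w * Z i\<close> congruent to a combination of the \<open>R j * V j i\<close>, of degree
  below \<open>s + E\<close>. Cancelling \<open>w\<close>, of degree \<open>s\<close>, leaves degree
  below \<open>E\<close>, whatever the degree of \<open>Y\<close>.\<close>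

lemma reduce_degree:
  fixes \<Delta> :: "int_mpoly poly" and p :: int and Y :: "nat \<Rightarrow> int_mpoly poly"
  assumes p: "p = 0 \<or> prime p" and K: "K > 0"
    and lead: "of_int p dvd coeff \<Delta> s - of_int c" "\<not> p dvd c"
    and high: "\<And>t. t > s \<Longrightarrow> of_int p dvd coeff \<Delta> t"
    and V: "\<And>i j. i < n \<Longrightarrow> j < n \<Longrightarrow> degree (V j i) \<le> E"
    and Y: "\<And>i. i < n \<Longrightarrow> of_int (p ^ K) dvd \<Delta> * Y i - (\<Sum>j<n. Y j * V j i)"
  obtains e Z Q where "\<not> p dvd e"
    "\<forall>i<n. \<forall>t\<ge>E. coeff (Z i) t = 0"
    "\<forall>i<n. of_int (p ^ K) dvd of_int e * Y i - (\<Sum>j<n. Q j * V j i) - Z i"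
proof -
  obtain u u' w b e where w: "degree w = s" "coeff w s = of_int b" "\<not> p dvd b"
    and uw: "of_int (p ^ K) dvd of_int e * \<Delta> - u * w"
    and u': "of_int (p ^ K) dvd u * u' - 1"
    by (rule weierstrass_factor[OF p K lead high])
  define I where "I = (of_int (p ^ K) :: int_mpoly poly)"
  have "b \<noteq> 0" using w(3) by auto
  with w(2) have "w \<noteq> 0" by auto
  have powb: "\<not> p dvd b ^ l" for l
    using p w(3) by (auto dest: prime_dvd_power)
  have "\<exists>l q r. of_int (b ^ l) * (u' * Y j) = w * q + r \<and> (\<forall>t\<ge>s. coeff r t = 0)" for j
  proof -
    obtain l q r where "smult (coeff w s ^ l) (u' * Y j) = w * q + r" "\<And>t. t \<ge> s \<Longrightarrow> coeff r t = 0"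
      using pseudo_division[OF w(1) \<open>w \<noteq> 0\<close>, of "u' * Y j"] by metis
    moreover have "of_int (b ^ l) * (u' * Y j) = smult (coeff w s ^ l) (u' * Y j)"
      using w(2) by (simp add: of_int_poly flip: of_int_power)
    ultimately show ?thesis by metis
  qed
  then obtain l q r where div: "\<And>j. of_int (b ^ l j) * (u' * Y j) = w * q j + r j"
    and r: "\<And>j t. t \<ge> s \<Longrightarrow> coeff (r j) t = 0"
    by metis
  \<comment> \<open>A common exponent, so that the single integer \<open>b ^ L\<close> multiplies
    the whole tuple.\<close>
  define L where "L = (\<Sum>j<n. l j)"
  define B where "B j = (of_int (b ^ (L - l j)) :: int_mpoly poly)" for j
  have B: "B j * of_int (b ^ l j) = of_int (b ^ L)" if "j < n" for j
  proof -
    have "l j \<le> L" unfolding L_def using that by (intro member_le_sum) auto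
    then have "b ^ (L - l j) * b ^ l j = b ^ L" by (simp flip: power_add)
    then show ?thesis unfolding B_def by (simp only: flip: of_int_mult)
  qed
  define Q where "Q j = of_int e * B j * q j" for j
  define R where "R j = B j * r j" for j
  have R: "coeff (R j) t = 0" if "t \<ge> s" for j t
    using r[OF that] by (simp add: R_def B_def of_int_poly del: of_int_power)
  have YR: "I dvd of_int (b ^ L) * Y j - \<Delta> * Q j - u * R j" if "j < n" for j
  proof -
    have "of_int (b ^ L) * (u' * Y j) = B j * (w * q j + r j)"
      using div[of j] B[OF that] by (metis mult.assoc)
    then have "u * R j = u * (of_int (b ^ L) * (u' * Y j)) - u * (B j * (w * q j))"
      by (simp add: R_def algebra_simps)
    then have "of_int (b ^ L) * Y j - \<Delta> * Q j - u * R j =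
        - (of_int (b ^ L) * Y j * (u * u' - 1)) - (B j * q j) * (of_int e * \<Delta> - u * w)"
      by (simp add: Q_def algebra_simps)
    then show ?thesis using uw u' unfolding I_def by simp
  qed
  define Z where "Z i = of_int (b ^ L) * Y i - (\<Sum>j<n. Q j * V j i)" for i
  define G where "G i = of_int e * (\<Sum>j<n. R j * V j i)" for i
  have wZ: "I dvd w * Z i - G i" if "i < n" for i
  proof -
    have "\<Delta> * Z i - u * (\<Sum>j<n. R j * V j i) =
        of_int (b ^ L) * (\<Delta> * Y i - (\<Sum>j<n. Y j * V j i)) +
        (\<Sum>j<n. (of_int (b ^ L) * Y j - \<Delta> * Q j - u * R j) * V j i)"
      by (simp add: Z_def left_diff_distrib right_diff_distrib sum_subtractf sum_distrib_left mult_ac)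
    also have "I dvd \<dots>"
      using Y[OF that] YR unfolding I_def by (intro dvd_add dvd_sum dvd_mult2 dvd_mult) auto
    finally have 1: "I dvd \<Delta> * Z i - u * (\<Sum>j<n. R j * V j i)" .
    have "w * Z i - G i = u' * of_int e * (\<Delta> * Z i - u * (\<Sum>j<n. R j * V j i)) -
        u' * Z i * (of_int e * \<Delta> - u * w) - (w * Z i - G i) * (u * u' - 1)"
      unfolding G_def by (simp add: algebra_simps)
    also have "I dvd \<dots>"
      by (rule dvd_diff[OF dvd_diff[OF dvd_mult[OF 1] dvd_mult[OF uw[folded I_def]]]
            dvd_mult[OF u'[folded I_def]]])
    finally show ?thesis .
  qed
  have G: "coeff (G i) t = 0" if "i < n" "t \<ge> s + E" for i t
  proof -
    have "coeff (R j * V j i) t = 0" if "j < n" for j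
    proof -
      have "coeff (R j) a * coeff (V j i) (t - a) = 0" for a
      proof (cases "a \<ge> s")
        case False
        with V[OF \<open>i < n\<close> that] \<open>t \<ge> s + E\<close> show ?thesis by (simp add: coeff_eq_0)
      qed (simp add: R)
      then show ?thesis by (simp only: coeff_mult sum.neutral_const)
    qed
    then show ?thesis by (simp add: G_def of_int_poly coeff_sum)
  qed
  have Zhigh: "of_int (p ^ K) dvd coeff (Z i) t" if "i < n" "t \<ge> E" for i t
  proof (rule coprime_lead_cancel[OF p K eq_refl[OF w(1)] w(2,3) _ \<open>t \<ge> E\<close>])
    fix t assume "t \<ge> s + E"
    from wZ[OF \<open>i < n\<close>] have "of_int (p ^ K) dvd coeff (w * Z i - G i) t"
      unfolding I_def of_int_dvd_poly_iff by blast
    with G[OF \<open>i < n\<close> \<open>t \<ge> s + E\<close>] show "of_int (p ^ K) dvd coeff (w * Z i) t" by simp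
  qed
  show thesis
  \<comment> \<open>The coefficients of \<open>Z i\<close> from \<open>E\<close> on are divisible by
    \<open>p ^ K\<close>. Cutting them off keeps the congruence and makes the degree bound
    exact.\<close>
  proof (rule that[of "b ^ L" "\<lambda>i. poly_cutoff E (Z i)" Q])
    show "\<not> p dvd b ^ L" by (rule powb)
    show "\<forall>i<n. \<forall>t\<ge>E. coeff (poly_cutoff E (Z i)) t = 0"
      by (simp add: coeff_poly_cutoff)
    have "of_int (p ^ K) dvd of_int (b ^ L) * Y i - (\<Sum>j<n. Q j * V j i) - poly_cutoff E (Z i)"
      if "i < n" for i
      using poly_cutoff_cong[of E "p ^ K" "Z i"] Zhigh[OF that] by (simp add: Z_def)
    then show "\<forall>i<n. of_int (p ^ K) dvd
        of_int (b ^ L) * Y i - (\<Sum>j<n. Q j * V j i) - poly_cutoff E (Z i)" by blast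
  qed
qed

section \<open>Change of variables\<close>

lemma digits_unique:
  fixes a b :: "nat \<Rightarrow> nat"
  assumes "\<And>i. i \<le> N \<Longrightarrow> a i < e \<and> b i < e"
    and "(\<Sum>i\<le>N. a i * e ^ (N - i)) = (\<Sum>i\<le>N. b i * e ^ (N - i))"
  shows "\<forall>i\<le>N. a i = b i"
  using assms
proof (induction N)
  case (Suc N)
  have split: "(\<Sum>i\<le>Suc N. c i * e ^ (Suc N - i)) = e * (\<Sum>i\<le>N. c i * e ^ (N - i)) + c (Suc N)"
    for c :: "nat \<Rightarrow> nat"
    by (simp add: Suc_diff_le sum_distrib_left mult_ac)
  have lt: "a (Suc N) < e" "b (Suc N) < e" using Suc.prems(1)[of "Suc N"] by auto
  have eq: "e * (\<Sum>i\<le>N. a i * e ^ (N - i)) + a (Suc N) =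
      e * (\<Sum>i\<le>N. b i * e ^ (N - i)) + b (Suc N)"
    using Suc.prems(2) unfolding split .
  from arg_cong[OF eq, of "\<lambda>x. x mod e"] lt have last: "a (Suc N) = b (Suc N)" by simp
  from arg_cong[OF eq, of "\<lambda>x. x div e"] lt
  have "(\<Sum>i\<le>N. a i * e ^ (N - i)) = (\<Sum>i\<le>N. b i * e ^ (N - i))" by simp
  with Suc.IH Suc.prems(1) have "\<forall>i\<le>N. a i = b i" by simp
  with last show ?case by (auto simp: le_Suc_eq)
qed simp

text \<open>
  Nagata's substitution: \<open>X\<^sub>N\<close> becomes the indeterminate of the univariate polynomial ring. The
  weights \<open>e ^ (N - i)\<close> separate monomials with all exponents below \<open>e\<close> (base-\<open>e\<close> digits), so
  different monomials have images of different degree.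
\<close>

definition to_poly_var :: "nat \<Rightarrow> nat \<Rightarrow> nat \<Rightarrow> int_mpoly poly" where
  "to_poly_var N e i =
    (if i < N then [:var i:] + monom 1 (e ^ (N - i)) else if i = N then monom 1 1 else [:var i:])"

text \<open>Undoes \<open>to_poly_var\<close> once the indeterminate is evaluated at
  \<open>var N\<close>. Both fix the variables of index above \<open>N\<close>, so
  \<open>of_poly_to_poly\<close> holds for all polynomials, as the unrestricted \<open>y\<close> in
  \<open>approximable\<close> requires.\<close>

definition of_poly_var :: "nat \<Rightarrow> nat \<Rightarrow> nat \<Rightarrow> int_mpoly" where
  "of_poly_var N e i = (if i < N then var i - var N ^ e ^ (N - i) else var i)"

definition to_poly :: "nat \<Rightarrow> nat \<Rightarrow> int_mpoly \<Rightarrow> int_mpoly poly" where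
  "to_poly N e = subst (to_poly_var N e)"

definition of_poly :: "nat \<Rightarrow> nat \<Rightarrow> int_mpoly poly \<Rightarrow> int_mpoly" where
  "of_poly N e P = poly (map_poly (subst (of_poly_var N e)) P) (var N)"

lemma comm_ring_hom_to_poly: "comm_ring_hom (to_poly N e)"
  unfolding to_poly_def by (rule comm_ring_hom_subst)

lemma comm_ring_hom_of_poly: "comm_ring_hom (of_poly N e)"
proof -
  interpret h: comm_ring_hom "subst (of_poly_var N e)" by (rule comm_ring_hom_subst)
  interpret m: map_poly_comm_ring_hom "subst (of_poly_var N e)" ..
  show ?thesis unfolding of_poly_def by unfold_locales (simp_all add: m.hom_add m.hom_mult)
qed

lemma of_poly_monom: "of_poly N e (monom a t) = subst (of_poly_var N e) a * var N ^ t"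
  by (simp add: of_poly_def map_poly_monom poly_monom)

lemma of_poly_to_poly: "of_poly N e (to_poly N e p) = p"
proof -
  interpret o: comm_ring_hom "of_poly N e" by (rule comm_ring_hom_of_poly)
  have "of_poly N e (to_poly_var N e i) = var i" for i
  proof -
    have const: "of_poly N e [:a:] = subst (of_poly_var N e) a" for a
      using of_poly_monom[of N e a 0] by (simp add: monom_0)
    show ?thesis
      by (auto simp: to_poly_var_def of_poly_monom const o.hom_add of_poly_var_def)
  qed
  then have "of_poly N e (to_poly N e p) = subst var p"
    unfolding to_poly_def hom_subst[OF comm_ring_hom_of_poly] by simp
  then show ?thesis by (simp add: subst_var_id)
qed

text \<open>Each variable goes to a polynomial whose coefficients have degree at most 1. So the
  coefficients keep the degree \<open>d\<close>, and only the degree in the indeterminate grows by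
  \<open>e ^ N\<close>. This is why \<open>d\<close> stays fixed in the recursion of
  \<open>solution_deg\<close>.\<close>

lemma to_poly_deg:
  assumes p: "p \<in> polys_deg_le (Suc N) d" and e: "e > 0"
  shows "degree (to_poly N e p) \<le> d * e ^ N" "coeff (to_poly N e p) t \<in> polys_deg_le N d"
proof -
  define F where "F k = {P :: int_mpoly poly. degree P \<le> k * e ^ N \<and> (\<forall>t. coeff P t \<in> polys_deg_le N k)}"
    for k
  have "subst (to_poly_var N e) p \<in> F d"
  proof (rule subst_filtration[OF p])
    fix i assume "i < Suc N"
    then have i: "i \<le> N" by simp
    have le: "e ^ (N - i) \<le> e ^ N" using e by (intro power_increasing) auto
    have one: "1 \<le> e ^ N" using e by simp
    have "coeff (to_poly_var N e i) t \<in> polys_deg_le N 1" for t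
      using i by (auto simp: to_poly_var_def coeff_pCons coeff_monom var_in split: nat.splits
          intro!: polys_deg_le_add)
    moreover have "degree (to_poly_var N e i) \<le> e ^ N"
      using le one i by (auto simp: to_poly_var_def degree_monom_eq intro!: degree_add_le)
    ultimately show "to_poly_var N e i \<in> F 1" by (simp add: F_def)
  next
    fix c :: int
    show "of_int c \<in> F 0"
      by (auto simp: F_def of_int_poly coeff_pCons split: nat.splits)
  next
    fix k x y assume "x \<in> F k" "y \<in> F k"
    then show "x + y \<in> F k" by (auto simp: F_def intro: polys_deg_le_add degree_add_le)
  next
    fix k l x y assume xy: "x \<in> F k" "y \<in> F l"
    then have "degree (x * y) \<le> k * e ^ N + l * e ^ N"
      unfolding F_def by (intro order.trans[OF degree_mult_le] add_mono) auto
    moreover have "coeff (x * y) t \<in> polys_deg_le N (k + l)" for t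
      using xy unfolding F_def coeff_mult by (auto intro!: polys_deg_le_sum polys_deg_le_mult)
    ultimately show "x * y \<in> F (k + l)" by (simp add: F_def algebra_simps)
  next
    fix k l x assume "x \<in> F k" "k \<le> l"
    then show "x \<in> F l"
      by (auto simp: F_def intro: polys_deg_le_mono order.trans mult_right_mono)
  qed
  then show "degree (to_poly N e p) \<le> d * e ^ N" "coeff (to_poly N e p) t \<in> polys_deg_le N d"
    by (auto simp: F_def to_poly_def)
qed

lemma of_poly_deg:
  assumes "\<And>t. coeff P t \<in> polys_deg_le N d" "degree P \<le> E" "e > 0"
  shows "of_poly N e P \<in> polys_deg_le (Suc N) (d * e ^ N + E)"
proof -
  have coef: "subst (of_poly_var N e) a \<in> polys_deg_le (Suc N) (d * e ^ N)"
    if "a \<in> polys_deg_le N d" for a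
  proof (rule subst_filtration[OF that, of _ "\<lambda>k. polys_deg_le (Suc N) (k * e ^ N)"])
    fix i assume "i < N"
    have "e ^ (N - i) \<le> e ^ N" using \<open>e > 0\<close> by (intro power_increasing) auto
    then have "var N ^ e ^ (N - i) \<in> polys_deg_le (Suc N) (e ^ N)"
      using polys_deg_le_power[OF var_in[of N "Suc N" 1], of "e ^ (N - i)"]
      by (auto intro: polys_deg_le_mono)
    with \<open>i < N\<close> \<open>e > 0\<close> show "of_poly_var N e i \<in> polys_deg_le (Suc N) (1 * e ^ N)"
      by (auto simp: of_poly_var_def intro!: polys_deg_le_diff var_in)
  next
    fix k l x y assume "x \<in> polys_deg_le (Suc N) (k * e ^ N)" "y \<in> polys_deg_le (Suc N) (l * e ^ N)"
    then show "x * y \<in> polys_deg_le (Suc N) ((k + l) * e ^ N)"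
      by (simp add: add_mult_distrib polys_deg_le_mult)
  next
    fix k l x assume "x \<in> polys_deg_le (Suc N) (k * e ^ N)" "k \<le> l"
    then show "x \<in> polys_deg_le (Suc N) (l * e ^ N)"
      by (auto intro: polys_deg_le_mono mult_right_mono)
  qed (auto intro: polys_deg_le_add)
  interpret o: comm_ring_hom "of_poly N e" by (rule comm_ring_hom_of_poly)
  have "of_poly N e P = (\<Sum>t\<le>degree P. subst (of_poly_var N e) (coeff P t) * var N ^ t)"
    by (subst poly_as_sum_of_monoms[symmetric]) (simp add: o.hom_sum of_poly_monom)
  also have "\<dots> \<in> polys_deg_le (Suc N) (d * e ^ N + E)"
  proof (intro polys_deg_le_sum polys_deg_le_mult coef assms(1))
    fix t assume "t \<in> {..degree P}"
    with assms(2) polys_deg_le_power[OF var_in[of N "Suc N" 1], of t]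
    show "var N ^ t \<in> polys_deg_le (Suc N) E" by (auto intro: polys_deg_le_mono)
  qed
  finally show ?thesis .
qed

text \<open>Each monomial goes to a monic polynomial whose degree is its weight \<open>wt\<close>,
  and \<open>D < e\<close> makes the weights of the monomials of \<open>\<Delta>\<close> distinct.
  The heaviest monomial with coefficient not divisible by \<open>p\<close> therefore gives the
  leading term modulo \<open>p\<close>, and \<open>c\<close> is its coefficient.\<close>

lemma to_poly_lead:
  fixes p :: int
  assumes \<Delta>: "\<Delta> \<in> polys_deg_le (Suc N) D" "\<not> of_int p dvd \<Delta>" and e: "D < e"
  obtains s c where "of_int p dvd coeff (to_poly N e \<Delta>) s - of_int c" "\<not> p dvd c"
    "\<And>t. t > s \<Longrightarrow> of_int p dvd coeff (to_poly N e \<Delta>) t"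
proof -
  define M where "M m = (\<Prod>i \<in> Poly_Mapping.keys m. to_poly_var N e i ^ Poly_Mapping.lookup m i)"
    for m :: "nat \<Rightarrow>\<^sub>0 nat"
  define wt where "wt m = (\<Sum>i\<le>N. Poly_Mapping.lookup m i * e ^ (N - i))" for m
  have "0 < e" using e by simp
  have v: "degree (to_poly_var N e i) = e ^ (N - i)" "lead_coeff (to_poly_var N e i) = 1" if le: "i \<le> N" for i
  proof -
    consider "i < N" | "i = N" using le by linarith
    then have "degree (to_poly_var N e i) = e ^ (N - i) \<and> lead_coeff (to_poly_var N e i) = 1"
    proof cases
      case 1
      have "0 < e ^ (N - i)" using \<open>0 < e\<close> by simp
      then have "degree ([:var i:] + monom 1 (e ^ (N - i))) = e ^ (N - i)"
        by (subst degree_add_eq_right) (simp_all add: degree_monom_eq)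
      with 1 \<open>0 < e ^ (N - i)\<close> show ?thesis
        by (simp add: to_poly_var_def coeff_pCons split: nat.splits)
    qed (simp add: to_poly_var_def degree_monom_eq)
    then show "degree (to_poly_var N e i) = e ^ (N - i)" "lead_coeff (to_poly_var N e i) = 1" by auto
  qed
  have M: "degree (M m) = wt m" "coeff (M m) (wt m) = 1" if "Poly_Mapping.keys m \<subseteq> {..<Suc N}" for m
  proof -
    have nz: "to_poly_var N e i \<noteq> 0" if "i \<le> N" for i using v(2)[OF that] by auto
    have "degree (M m) = (\<Sum>i\<in>Poly_Mapping.keys m. Poly_Mapping.lookup m i * e ^ (N - i))"
      unfolding M_def
      by (subst degree_prod_eq_sum_degree) (use that nz v in \<open>auto simp: degree_power_eq intro!: sum.cong\<close>)
    also have "\<dots> = wt m" unfolding wt_def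
      by (rule sum.mono_neutral_left) (use that in \<open>auto simp: in_keys_iff\<close>)
    finally show deg: "degree (M m) = wt m" .
    have "lead_coeff (M m) = 1" unfolding M_def lead_coeff_prod lead_coeff_power
      by (rule prod.neutral) (use that v(2) in auto)
    with deg show "coeff (M m) (wt m) = 1" by simp
  qed
  have coeff_M: "coeff (to_poly N e \<Delta>) t =
      (\<Sum>m\<in>Poly_Mapping.keys \<Delta>. of_int (Poly_Mapping.lookup \<Delta> m) * coeff (M m) t)" for t
    by (simp add: to_poly_def subst_def M_def coeff_sum of_int_poly)
  have keys: "Poly_Mapping.keys m \<subseteq> {..<Suc N}" "monom_degree m \<le> D" if "m \<in> Poly_Mapping.keys \<Delta>" for m
    using \<Delta>(1) that by (auto simp: polys_deg_le_def)
  have inj: "m = m'" if m: "m \<in> Poly_Mapping.keys \<Delta>" and m': "m' \<in> Poly_Mapping.keys \<Delta>"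
    and wt: "wt m = wt m'" for m m'
  proof -
    have small: "Poly_Mapping.lookup k i < e" if "k \<in> Poly_Mapping.keys \<Delta>" for k i
    proof (cases "i \<in> Poly_Mapping.keys k")
      case True
      then have "Poly_Mapping.lookup k i \<le> monom_degree k"
        unfolding monom_degree_def by (intro member_le_sum) auto
      with keys(2)[OF that] e show ?thesis by simp
    qed (use \<open>0 < e\<close> in \<open>simp add: in_keys_iff\<close>)
    have "\<forall>i\<le>N. Poly_Mapping.lookup m i = Poly_Mapping.lookup m' i"
      by (rule digits_unique) (use small m m' wt in \<open>auto simp: wt_def\<close>)
    moreover have "Poly_Mapping.lookup k i = 0" if "k \<in> Poly_Mapping.keys \<Delta>" "i > N" for k i
      using keys(1)[OF that(1)] that(2) by (auto simp: in_keys_iff)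
    ultimately show ?thesis
      using m m' by (intro poly_mapping_eqI) (metis not_le)
  qed
  define S where "S = {m \<in> Poly_Mapping.keys \<Delta>. \<not> p dvd Poly_Mapping.lookup \<Delta> m}"
  have "finite S" by (simp add: S_def)
  have "S \<noteq> {}"
  proof
    assume "S = {}"
    then have "p dvd Poly_Mapping.lookup \<Delta> m" for m
      by (cases "m \<in> Poly_Mapping.keys \<Delta>") (auto simp: S_def in_keys_iff)
    with \<Delta>(2) show False by (simp add: of_int_dvd_iff)
  qed
  with \<open>finite S\<close> have "Max (wt ` S) \<in> wt ` S" by simp
  then obtain m0 where m0: "m0 \<in> S" "wt m0 = Max (wt ` S)" by auto
  then have max: "wt m \<le> wt m0" if "m \<in> S" for m using that \<open>finite S\<close> by simp
  have "m0 \<in> Poly_Mapping.keys \<Delta>" using m0 by (simp add: S_def)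
  have dvd_term: "of_int p dvd of_int (Poly_Mapping.lookup \<Delta> m) * coeff (M m) t"
    if "m \<in> Poly_Mapping.keys \<Delta>" "t \<ge> wt m0" "m \<noteq> m0 \<or> t > wt m0" for m t
  proof (cases "m \<in> S")
    case True
    with max inj[OF that(1) \<open>m0 \<in> Poly_Mapping.keys \<Delta>\<close>] that have "wt m < t"
      by (metis le_neq_implies_less le_less_trans less_le_trans)
    with M(1)[OF keys(1)[OF that(1)]] show ?thesis by (simp add: coeff_eq_0)
  next
    case False
    with that(1) have "p dvd Poly_Mapping.lookup \<Delta> m" by (simp add: S_def)
    then show ?thesis by (auto simp: dvd_def mult.assoc)
  qed
  show thesis
  proof (rule that[of "wt m0" "Poly_Mapping.lookup \<Delta> m0"])
    have "coeff (to_poly N e \<Delta>) (wt m0) = of_int (Poly_Mapping.lookup \<Delta> m0) +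
      (\<Sum>m\<in>Poly_Mapping.keys \<Delta> - {m0}. of_int (Poly_Mapping.lookup \<Delta> m) * coeff (M m) (wt m0))"
      unfolding coeff_M using \<open>m0 \<in> Poly_Mapping.keys \<Delta>\<close> M(2)[OF keys(1)[OF \<open>m0 \<in> Poly_Mapping.keys \<Delta>\<close>]]
      by (subst sum.remove) auto
    then show "of_int p dvd coeff (to_poly N e \<Delta>) (wt m0) - of_int (Poly_Mapping.lookup \<Delta> m0)"
      by (auto intro!: dvd_sum dvd_term)
    show "\<not> p dvd Poly_Mapping.lookup \<Delta> m0" using m0 by (simp add: S_def)
    show "of_int p dvd coeff (to_poly N e \<Delta>) t" if "t > wt m0" for t
      unfolding coeff_M using that by (intro dvd_sum dvd_term) auto
  qed
qed

section \<open>Comparing coefficients in the eliminated variable\<close>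

definition assemble :: "nat \<Rightarrow> (nat \<Rightarrow> int_mpoly) \<Rightarrow> nat \<Rightarrow> int_mpoly poly" where
  "assemble E z j = (\<Sum>t<E. monom (z (j * E + t)) t)"

lemma coeff_assemble: "coeff (assemble E z j) t = (if t < E then z (j * E + t) else 0)"
  by (simp add: assemble_def coeff_sum coeff_monom)

text \<open>
  Row \<open>k * (2 * E) + s\<close> is the coefficient of the \<open>s\<close>-th power in the \<open>k\<close>-th equation, and column
  \<open>j * E + t\<close> is the \<open>t\<close>-th coefficient of the \<open>j\<close>-th unknown, of degree below \<open>E\<close>. If the
  entries of \<open>P\<close> have degree at most \<open>E\<close>, only \<open>s < 2 * E\<close> matters.
\<close>

definition coeff_system :: "nat \<Rightarrow> (nat \<Rightarrow> nat \<Rightarrow> int_mpoly poly) \<Rightarrow> nat \<Rightarrow> nat \<Rightarrow> int_mpoly" where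
  "coeff_system E P i l = (if l mod E \<le> i mod (2 * E)
    then coeff (P (i div (2 * E)) (l div E)) (i mod (2 * E) - l mod E) else 0)"

lemma coeff_system_row:
  assumes "s < 2 * E"
  shows "(\<Sum>l<n * E. coeff_system E P (k * (2 * E) + s) l * z l) =
    coeff (\<Sum>j<n. P k j * assemble E z j) s"
proof -
  have E: "E > 0" using assms by simp
  have idx: "(k * (2 * E) + s) div (2 * E) = k" "(k * (2 * E) + s) mod (2 * E) = s"
    using assms by auto
  have "(\<Sum>l<n * E. coeff_system E P (k * (2 * E) + s) l * z l) =
      (\<Sum>j<n. \<Sum>l=j * E..<j * E + E. coeff_system E P (k * (2 * E) + s) l * z l)"
    by (rule sum.nat_group[symmetric])
  also have "\<dots> = (\<Sum>j<n. \<Sum>t<E. (if t \<le> s then coeff (P k j) (s - t) else 0) * z (j * E + t))"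
  proof (rule sum.cong[OF refl])
    fix j
    have "(\<Sum>l=j * E..<j * E + E. coeff_system E P (k * (2 * E) + s) l * z l) =
        (\<Sum>t<E. coeff_system E P (k * (2 * E) + s) (t + j * E) * z (t + j * E))"
      using sum.shift_bounds_nat_ivl[of _ 0 "j * E" E] by (simp add: atLeast0LessThan add.commute)
    also have "\<dots> = (\<Sum>t<E. (if t \<le> s then coeff (P k j) (s - t) else 0) * z (j * E + t))"
      unfolding coeff_system_def idx by (intro sum.cong refl) (use E in \<open>simp add: add.commute\<close>)
    finally show "(\<Sum>l=j * E..<j * E + E. coeff_system E P (k * (2 * E) + s) l * z l) =
        (\<Sum>t<E. (if t \<le> s then coeff (P k j) (s - t) else 0) * z (j * E + t))" .
  qed
  also have "\<dots> = (\<Sum>j<n. coeff (P k j * assemble E z j) s)"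
  proof (rule sum.cong[OF refl])
    fix j
    have "coeff (P k j * assemble E z j) s = (\<Sum>t\<le>s. coeff (assemble E z j) t * coeff (P k j) (s - t))"
      by (subst mult.commute) (rule coeff_mult)
    also have "\<dots> = (\<Sum>t<E + Suc s. (if t \<le> s then coeff (P k j) (s - t) else 0) *
        (if t < E then z (j * E + t) else 0))"
      by (rule sum.mono_neutral_cong_left) (auto simp: coeff_assemble)
    also have "\<dots> = (\<Sum>t<E. (if t \<le> s then coeff (P k j) (s - t) else 0) * z (j * E + t))"
      by (rule sum.mono_neutral_cong_right) auto
    finally show "(\<Sum>t<E. (if t \<le> s then coeff (P k j) (s - t) else 0) * z (j * E + t)) =
      coeff (P k j * assemble E z j) s" by simp
  qed
  finally show ?thesis by (simp add: coeff_sum)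
qed

section \<open>Approximating solutions modulo prime powers\<close>

text \<open>The coefficients may involve any variables, and tuples are functions on all of
  \<open>nat\<close>, compared only below \<open>n\<close>. The restriction to \<open>N\<close>
  variables is restored at the end by \<open>retract\<close>.\<close>

inductive_set lin_span :: "(nat \<Rightarrow> int_mpoly) set \<Rightarrow> (nat \<Rightarrow> int_mpoly) set" for G where
  lin_span_zero: "(\<lambda>_. 0) \<in> lin_span G"
| lin_span_step: "g \<in> G \<Longrightarrow> z \<in> lin_span G \<Longrightarrow> (\<lambda>j. a * g j + z j) \<in> lin_span G"

lemma lin_span_add:
  assumes "x \<in> lin_span G" "y \<in> lin_span G"
  shows "(\<lambda>j. x j + y j) \<in> lin_span G"
  using assms
proof (induction rule: lin_span.induct)
  case (lin_span_step g z a)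
  then have "(\<lambda>j. a * g j + (z j + y j)) \<in> lin_span G" by (intro lin_span.intros)
  then show ?case by (simp add: add.assoc)
qed simp

lemma lin_span_sum:
  "(\<And>i. i \<in> I \<Longrightarrow> g i \<in> G) \<Longrightarrow> (\<lambda>j. \<Sum>i\<in>I. a i * g i j) \<in> lin_span G"
proof (induction I rule: infinite_finite_induct)
  case (insert i I)
  then have "(\<lambda>j. a i * g i j + (\<Sum>i\<in>I. a i * g i j)) \<in> lin_span G"
    by (intro lin_span_step) auto
  with insert show ?case by simp
qed (simp_all add: lin_span_zero)

definition bounded_solutions ::
    "nat \<Rightarrow> nat \<Rightarrow> nat \<Rightarrow> nat \<Rightarrow> (nat \<Rightarrow> nat \<Rightarrow> int_mpoly) \<Rightarrow> (nat \<Rightarrow> int_mpoly) set" where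
  "bounded_solutions N m n b A =
    {g. (\<forall>j<n. g j \<in> polys_deg_le N b) \<and> (\<forall>i<m. (\<Sum>j<n. A i j * g j) = 0)}"

text \<open>
  With \<open>e = m * d + 1\<close> and \<open>E = m * d * e ^ N\<close>, eliminating a variable turns \<open>m\<close> equations into
  \<open>2 * m * E\<close>, and undoing the change of variables multiplies degrees by at most \<open>e ^ N\<close>.
\<close>

fun solution_deg :: "nat \<Rightarrow> nat \<Rightarrow> nat \<Rightarrow> nat" where
  "solution_deg 0 m d = 0"
| "solution_deg (Suc N) m d =
    solution_deg N (m * (2 * (m * d * (m * d + 1) ^ N))) d * (m * d + 1) ^ N + m * d * (m * d + 1) ^ N"

lemma polys_deg_le_0_vars:
  assumes "p \<in> polys_deg_le 0 d"
  obtains c where "p = of_int c"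
proof -
  have "Poly_Mapping.lookup p m = 0" if "m \<noteq> 0" for m
    using assms that in_keys_iff[of m p] by (auto simp: polys_deg_le_def)
  then have "p = Poly_Mapping.single 0 (Poly_Mapping.lookup p 0)"
    by (intro poly_mapping_eqI) (auto simp: lookup_single when_def)
  then show thesis by (intro that) (simp only: of_int_eq_single)
qed

lemma prime_or_zero_mult:
  fixes p :: int
  assumes "p = 0 \<or> prime p" "\<not> p dvd a" "\<not> p dvd b"
  shows "\<not> p dvd a * b"
  using assms by (auto dest: prime_dvd_multD)

text \<open>The loss of precision \<open>c\<close> is chosen before \<open>K\<close> and
  \<open>y\<close>; this uniformity later bounds the torsion. For \<open>p = 0\<close> and
  \<open>K > 0\<close> the moduli are 0, so every exact solution has a nonzero integer multiple in
  the span.\<close>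

definition approximable ::
    "int \<Rightarrow> nat \<Rightarrow> nat \<Rightarrow> (nat \<Rightarrow> nat \<Rightarrow> int_mpoly) \<Rightarrow> (nat \<Rightarrow> int_mpoly) set \<Rightarrow> bool" where
  "approximable p m n A G \<longleftrightarrow> (\<exists>c. \<forall>K>0. \<forall>y.
    (\<forall>i<m. of_int (p ^ (K + c)) dvd (\<Sum>j<n. A i j * y j)) \<longrightarrow>
    (\<exists>e. \<exists>z \<in> lin_span G. \<not> p dvd e \<and> (\<forall>j<n. of_int (p ^ K) dvd of_int e * y j - z j)))"

text \<open>Without variables \<open>\<Delta>\<close> is an integer not divisible by
  \<open>p\<close>, so it serves as the factor and the Cramer solutions suffice.\<close>

lemma approximable_0_vars:
  assumes p: "p = 0 \<or> prime p"
    and A: "\<And>i j. i < m \<Longrightarrow> j < n \<Longrightarrow> A i j \<in> polys_deg_le 0 d"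
  shows "approximable p m n A (bounded_solutions 0 m n 0 A)"
proof -
  obtain \<Delta> V v where \<Delta>: "\<Delta> \<in> polys_deg_le 0 (m * d)" "\<not> of_int p dvd \<Delta>"
    and V: "\<forall>i<n. \<forall>j<n. V j i \<in> polys_deg_le 0 (m * d)"
    and AV: "\<forall>k<m. \<forall>j<n. (\<Sum>i<n. A k i * V j i) = 0"
    and red: "\<forall>q y. (\<forall>k<m. of_int (p ^ v * q) dvd (\<Sum>j<n. A k j * y j)) \<longrightarrow>
      (\<forall>i<n. of_int q dvd \<Delta> * y i - (\<Sum>j<n. y j * V j i))"
    by (rule minor_relations[OF p, of m n A 0 d], rule A)
  note V = V[rule_format] and AV = AV[rule_format] and red = red[rule_format]
  obtain e where e: "\<Delta> = of_int e" using \<Delta>(1) by (rule polys_deg_le_0_vars)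
  have "\<not> p dvd e" using \<Delta>(2) by (auto simp: e dvd_def)
  have "V j i \<in> polys_deg_le 0 0" if "i < n" "j < n" for i j
    using polys_deg_le_0_vars[OF V[OF that]] by fastforce
  then have V': "V j \<in> bounded_solutions 0 m n 0 A" if "j < n" for j
    using that AV by (simp add: bounded_solutions_def)
  show ?thesis unfolding approximable_def
  proof (intro exI[of _ v] allI impI)
    fix K y assume "\<forall>i<m. of_int (p ^ (K + v)) dvd (\<Sum>j<n. A i j * y j)"
    then have "of_int (p ^ K) dvd \<Delta> * y i - (\<Sum>j<n. y j * V j i)" if "i < n" for i
      using that by (intro red) (simp_all add: power_add mult.commute)
    moreover have "(\<lambda>i. \<Sum>j<n. y j * V j i) \<in> lin_span (bounded_solutions 0 m n 0 A)"
      by (rule lin_span_sum) (simp add: V')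
    ultimately show "\<exists>e. \<exists>z \<in> lin_span (bounded_solutions 0 m n 0 A). \<not> p dvd e \<and>
        (\<forall>j<n. of_int (p ^ K) dvd of_int e * y j - z j)"
      using \<open>\<not> p dvd e\<close> unfolding e
      by (intro exI[of _ e] bexI[of _ "\<lambda>i. \<Sum>j<n. y j * V j i"] conjI allI impI)
  qed
qed

text \<open>After the change of variables, \<open>reduce_degree\<close> writes a multiple of
  \<open>y\<close> as a combination of Cramer solutions plus a tuple \<open>Z\<close> of degree
  below \<open>E\<close> in the indeterminate. The coefficients of \<open>Z\<close> approximately
  solve the system \<open>A'\<close> in \<open>N\<close> variables, to which \<open>IH\<close>
  applies, and \<open>\<Phi>\<close> carries its solutions back. \<open>A'\<close> depends on
  neither \<open>y\<close> nor \<open>K\<close>, so neither does the loss \<open>c'\<close>.\<close>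

lemma approximable_Suc_vars:
  fixes A :: "nat \<Rightarrow> nat \<Rightarrow> int_mpoly"
  assumes p: "p = 0 \<or> prime p"
    and A: "\<And>i j. i < m \<Longrightarrow> j < n \<Longrightarrow> A i j \<in> polys_deg_le (Suc N) d"
    and e_def: "e = m * d + 1" and E_def: "E = m * d * e ^ N"
    and IH: "\<And>A'. (\<And>i j. i < m * (2 * E) \<Longrightarrow> j < n * E \<Longrightarrow> A' i j \<in> polys_deg_le N d) \<Longrightarrow>
      approximable p (m * (2 * E)) (n * E) A' (bounded_solutions N (m * (2 * E)) (n * E) b A')"
  shows "approximable p m n A (bounded_solutions (Suc N) m n (b * e ^ N + E) A)"
proof -
  let ?S = "bounded_solutions (Suc N) m n (b * e ^ N + E) A"
  have "e > 0" by (simp add: e_def)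
  interpret \<Psi>: comm_ring_hom "to_poly N e" by (rule comm_ring_hom_to_poly)
  interpret \<Theta>: comm_ring_hom "of_poly N e" by (rule comm_ring_hom_of_poly)
  obtain \<Delta> V v where \<Delta>: "\<Delta> \<in> polys_deg_le (Suc N) (m * d)" "\<not> of_int p dvd \<Delta>"
    and V: "\<forall>i<n. \<forall>j<n. V j i \<in> polys_deg_le (Suc N) (m * d)"
    and AV: "\<forall>k<m. \<forall>j<n. (\<Sum>i<n. A k i * V j i) = 0"
    and red: "\<forall>q y. (\<forall>k<m. of_int (p ^ v * q) dvd (\<Sum>j<n. A k j * y j)) \<longrightarrow>
      (\<forall>i<n. of_int q dvd \<Delta> * y i - (\<Sum>j<n. y j * V j i))"
    by (rule minor_relations[OF p, of m n A "Suc N" d], rule A)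
  note V = V[rule_format] and AV = AV[rule_format] and red = red[rule_format]
  obtain s c where lead: "of_int p dvd coeff (to_poly N e \<Delta>) s - of_int c" "\<not> p dvd c"
    and high: "\<And>t. t > s \<Longrightarrow> of_int p dvd coeff (to_poly N e \<Delta>) t"
    using to_poly_lead[OF \<Delta>, of e] by (auto simp: e_def)
  define P where "P i j = to_poly N e (A i j)" for i j
  define A' where "A' = coeff_system E P"
  have P_coeff: "coeff (P i j) t \<in> polys_deg_le N d" if "i < m" "j < n" for i j t
    unfolding P_def by (rule to_poly_deg[OF A[OF that] \<open>e > 0\<close>])
  have P_deg: "degree (P i j) \<le> E" if "i < m" "j < n" for i j
  proof -
    have "degree (P i j) \<le> d * e ^ N" unfolding P_def by (rule to_poly_deg[OF A[OF that] \<open>e > 0\<close>])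
    also have "\<dots> \<le> E" using that(1) by (simp add: E_def)
    finally show ?thesis .
  qed
  have "A' i j \<in> polys_deg_le N d" if "i < m * (2 * E)" "j < n * E" for i j
  proof -
    have "i div (2 * E) < m" "j div E < n"
      using that by (simp_all add: less_mult_imp_div_less)
    then show ?thesis by (simp add: A'_def coeff_system_def P_coeff)
  qed
  from IH[OF this] obtain c' where c': "\<forall>K>0. \<forall>y.
    (\<forall>i<m * (2 * E). of_int (p ^ (K + c')) dvd (\<Sum>j<n * E. A' i j * y j)) \<longrightarrow>
    (\<exists>e. \<exists>z \<in> lin_span (bounded_solutions N (m * (2 * E)) (n * E) b A').
      \<not> p dvd e \<and> (\<forall>j<n * E. of_int (p ^ K) dvd of_int e * y j - z j))"
    unfolding approximable_def by (rule exE)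
  define \<Phi> where "\<Phi> z j = of_poly N e (assemble E z j)" for z j
  have \<Phi>_sol: "\<Phi> g \<in> ?S" if g: "g \<in> bounded_solutions N (m * (2 * E)) (n * E) b A'" for g
    unfolding bounded_solutions_def
  proof (intro CollectI conjI allI impI)
    fix j assume "j < n"
    have "coeff (assemble E g j) t \<in> polys_deg_le N b" for t
    proof (cases "t < E")
      case True
      have "j * E + t < Suc j * E" using True by simp
      also have "\<dots> \<le> n * E" using \<open>j < n\<close> by (intro mult_right_mono) auto
      finally show ?thesis using g True by (simp add: coeff_assemble bounded_solutions_def)
    qed (simp add: coeff_assemble)
    moreover have "degree (assemble E g j) \<le> E"
      by (rule degree_le) (simp add: coeff_assemble)
    ultimately show "\<Phi> g j \<in> polys_deg_le (Suc N) (b * e ^ N + E)"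
      unfolding \<Phi>_def using \<open>e > 0\<close> by (rule of_poly_deg)
  next
    fix i assume "i < m"
    have "(\<Sum>j<n. P i j * assemble E g j) = 0"
    proof (rule poly_eqI)
      fix t
      show "coeff (\<Sum>j<n. P i j * assemble E g j) t = coeff 0 t"
      proof (cases "t < 2 * E")
        case True
        have "i * (2 * E) + t < Suc i * (2 * E)" using True by simp
        also have "\<dots> \<le> m * (2 * E)" using \<open>i < m\<close> by (intro mult_right_mono) auto
        finally have "(\<Sum>l<n * E. A' (i * (2 * E) + t) l * g l) = 0"
          using g by (simp add: bounded_solutions_def)
        then show ?thesis unfolding A'_def coeff_system_row[OF True] by simp
      next
        case False
        \<comment> \<open>A factor of degree at most \<open>E\<close> times one of degree below
          \<open>E\<close> never reaches \<open>2 * E\<close>, so the rows of \<open>A'\<close>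
          capture all coefficients.\<close>
        have "coeff (P i j * assemble E g j) t = 0" if "j < n" for j
        proof -
          have "coeff (P i j) a * coeff (assemble E g j) (t - a) = 0" for a
          proof (cases "a \<le> E")
            case False
            with P_deg[OF \<open>i < m\<close> that] show ?thesis by (simp add: coeff_eq_0)
          qed (use \<open>\<not> t < 2 * E\<close> in \<open>simp add: coeff_assemble\<close>)
          then show ?thesis by (simp only: coeff_mult sum.neutral_const)
        qed
        then show ?thesis by (simp add: coeff_sum)
      qed
    qed
    from arg_cong[OF this, of "of_poly N e"]
    show "(\<Sum>j<n. A i j * \<Phi> g j) = 0"
      by (simp add: \<Theta>.hom_sum \<Theta>.hom_mult P_def of_poly_to_poly \<Phi>_def)
  qed
  have \<Phi>_span: "\<Phi> z \<in> lin_span ?S" if "z \<in> lin_span (bounded_solutions N (m * (2 * E)) (n * E) b A')" for z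
    using that
  proof (induction rule: lin_span.induct)
    case lin_span_zero
    have "\<Phi> (\<lambda>_. 0) = (\<lambda>_. 0)" by (simp add: \<Phi>_def assemble_def fun_eq_iff)
    then show ?case by (simp add: lin_span.lin_span_zero)
  next
    case (lin_span_step g z a)
    have "assemble E (\<lambda>j. a * g j + z j) j = [:a:] * assemble E g j + assemble E z j" for j
      by (rule poly_eqI) (simp add: coeff_assemble)
    \<comment> \<open>\<open>\<Phi>\<close> is only semilinear: the coefficient \<open>a\<close> is
      transformed as well, which \<open>lin_span\<close> permits.\<close>
    then have "\<Phi> (\<lambda>j. a * g j + z j) = (\<lambda>j. of_poly N e [:a:] * \<Phi> g j + \<Phi> z j)"
      by (simp add: \<Phi>_def fun_eq_iff \<Theta>.hom_add \<Theta>.hom_mult del: mult_pCons_left)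
    with lin_span_step show ?case by (simp add: lin_span.lin_span_step \<Phi>_sol)
  qed
  have V_sol: "V j \<in> ?S" if "j < n" for j
  proof -
    have "m * d \<le> b * e ^ N + E" using \<open>e > 0\<close> by (simp add: E_def trans_le_add2)
    with that V AV show ?thesis by (auto simp: bounded_solutions_def intro: polys_deg_le_mono)
  qed
  show ?thesis unfolding approximable_def
  \<comment> \<open>\<open>v\<close> is spent on the division by \<open>p ^ v\<close> in
    \<open>minor_relations\<close>, \<open>c'\<close> on the system in fewer variables.\<close>
  proof (intro exI[of _ "c' + v"] allI impI)
    fix K :: nat and y assume "K > 0" and y: "\<forall>i<m. of_int (p ^ (K + (c' + v))) dvd (\<Sum>j<n. A i j * y j)"
    define q where "q = p ^ (K + c')"
    have yq: "of_int (p ^ v * q) dvd (\<Sum>j<n. A i j * y j)" if "i < m" for i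
    proof -
      have "p ^ v * q = p ^ (K + (c' + v))" by (simp add: q_def power_add mult_ac)
      with y that show ?thesis by simp
    qed
    have yq': "of_int q dvd (\<Sum>j<n. A i j * y j)" if "i < m" for i
      using yq[OF that] by (auto dest: dvd_mult_right)
    define Y where "Y j = to_poly N e (y j)" for j
    define W where "W j i = to_poly N e (V j i)" for j i
    have hom_dvd: "of_int r dvd to_poly N e x" if "of_int r dvd x" for r x
      using \<Psi>.hom_dvd[OF that] by (simp only: \<Psi>.hom_of_int)
    have hom_dvd': "of_int r dvd of_poly N e x" if "of_int r dvd x" for r x
      using \<Theta>.hom_dvd[OF that] by (simp only: \<Theta>.hom_of_int)
    have YW: "of_int (p ^ (K + c')) dvd to_poly N e \<Delta> * Y i - (\<Sum>j<n. Y j * W j i)" if "i < n" for i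
      using hom_dvd[OF red[OF yq that]]
      by (simp only: Y_def W_def \<Psi>.hom_minus \<Psi>.hom_mult \<Psi>.hom_sum q_def)
    have W_deg: "degree (W j i) \<le> E" if "i < n" "j < n" for i j
      unfolding W_def E_def by (rule to_poly_deg[OF V[OF that] \<open>e > 0\<close>])
    have "K + c' > 0" using \<open>K > 0\<close> by simp
    obtain e1 Z Q where e1: "\<not> p dvd e1"
      and Z: "\<forall>i<n. \<forall>t\<ge>E. coeff (Z i) t = 0"
      and YZ: "\<forall>i<n. of_int (p ^ (K + c')) dvd of_int e1 * Y i - (\<Sum>j<n. Q j * W j i) - Z i"
      by (rule reduce_degree[OF p \<open>K + c' > 0\<close> lead, of n W E Y], rule high, assumption,
          rule W_deg, assumption, assumption, rule YW, assumption)
    note Z = Z[rule_format] and YZ = YZ[folded q_def, rule_format]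
    define z where "z l = coeff (Z (l div E)) (l mod E)" for l
    have assemble_z: "assemble E z j = Z j" if "j < n" for j
      by (rule poly_eqI) (use Z[OF that] in \<open>auto simp: coeff_assemble z_def\<close>)
    have PZ: "of_int q dvd (\<Sum>j<n. P i j * Z j)" if "i < m" for i
    proof -
      have "(\<Sum>j<n. P i j * W l j) = 0" if "l < n" for l
        using arg_cong[OF AV[OF \<open>i < m\<close> that], of "to_poly N e"]
        by (simp add: P_def W_def \<Psi>.hom_sum \<Psi>.hom_mult)
      \<comment> \<open>The \<open>W l\<close> are exact solutions, so their multiples drop out and
        \<open>Z\<close> inherits the approximate equations of \<open>Y\<close>.\<close>
      then have PQW: "(\<Sum>j<n. P i j * (\<Sum>l<n. Q l * W l j)) = 0"
      proof -
        have "(\<Sum>j<n. P i j * (\<Sum>l<n. Q l * W l j)) = (\<Sum>l<n. Q l * (\<Sum>j<n. P i j * W l j))"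
          unfolding sum_distrib_left by (subst sum.swap) (simp add: mult_ac)
        also have "\<dots> = 0" by (rule sum.neutral) (simp add: \<open>\<And>l. l < n \<Longrightarrow> (\<Sum>j<n. P i j * W l j) = 0\<close>)
        finally show ?thesis .
      qed
      have "(\<Sum>j<n. P i j * Z j) = of_int e1 * (\<Sum>j<n. P i j * Y j) -
          (\<Sum>j<n. P i j * (of_int e1 * Y j - (\<Sum>l<n. Q l * W l j) - Z j))"
        using PQW by (simp add: right_diff_distrib sum_subtractf sum_distrib_left mult_ac)
      moreover have "of_int q dvd (\<Sum>j<n. P i j * Y j)"
        using hom_dvd[OF yq'[OF that]] by (simp add: P_def Y_def \<Psi>.hom_sum \<Psi>.hom_mult)
      moreover have "of_int q dvd (\<Sum>j<n. P i j * (of_int e1 * Y j - (\<Sum>l<n. Q l * W l j) - Z j))"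
        by (intro dvd_sum dvd_mult YZ) auto
      ultimately show ?thesis by (simp add: dvd_diff)
    qed
    have "\<forall>i<m * (2 * E). of_int (p ^ (K + c')) dvd (\<Sum>l<n * E. A' i l * z l)"
    proof (intro allI impI)
      fix i assume i: "i < m * (2 * E)"
      then have t: "i mod (2 * E) < 2 * E" by (intro mod_less_divisor) (auto intro: Nat.gr0I)
      have "(\<Sum>l<n * E. A' i l * z l) = coeff (\<Sum>j<n. P (i div (2 * E)) j * assemble E z j) (i mod (2 * E))"
        unfolding A'_def using coeff_system_row[OF t, where n = n and P = P and k = "i div (2 * E)" and z = z]
        by (simp only: div_mult_mod_eq)
      also have "(\<Sum>j<n. P (i div (2 * E)) j * assemble E z j) = (\<Sum>j<n. P (i div (2 * E)) j * Z j)"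
        by (simp add: assemble_z)
      finally show "of_int (p ^ (K + c')) dvd (\<Sum>l<n * E. A' i l * z l)"
        using PZ[of "i div (2 * E)"] i unfolding q_def of_int_dvd_poly_iff
        by (simp add: less_mult_imp_div_less)
    qed
    from c'[THEN spec, THEN mp, THEN spec, THEN mp, OF \<open>K > 0\<close> this] obtain e2 z' where e2: "\<not> p dvd e2"
      and z': "z' \<in> lin_span (bounded_solutions N (m * (2 * E)) (n * E) b A')"
      and zz': "\<And>l. l < n * E \<Longrightarrow> of_int (p ^ K) dvd of_int e2 * z l - z' l" by blast
    \<comment> \<open>Scale the decomposition of \<open>e1 * Y\<close> by \<open>e2\<close>, replace
      \<open>e2 * Z\<close> by its approximation from \<open>z'\<close>, and undo the change of
      variables.\<close>
    define x where "x i = (\<Sum>j<n. (of_int e2 * of_poly N e (Q j)) * V j i) + \<Phi> z' i" for i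
    have "x \<in> lin_span ?S"
      unfolding x_def by (intro lin_span_add lin_span_sum \<Phi>_span z') (simp add: V_sol)
    moreover have "of_int (p ^ K) dvd of_int (e2 * e1) * y i - x i" if "i < n" for i
    proof -
      have "of_int (p ^ K) dvd of_int e2 * Z i - assemble E z' i"
        unfolding of_int_dvd_poly_iff
      proof
        fix t
        show "of_int (p ^ K) dvd coeff (of_int e2 * Z i - assemble E z' i) t"
        proof (cases "t < E")
          case True
          have "i * E + t < Suc i * E" using True by simp
          also have "\<dots> \<le> n * E" using \<open>i < n\<close> by (intro mult_right_mono) auto
          finally show ?thesis using zz'[of "i * E + t"] True
            by (simp add: coeff_assemble z_def of_int_poly)
        qed (use Z[OF that] in \<open>simp add: coeff_assemble of_int_poly\<close>)
      qed
      moreover have "of_int (p ^ K) dvd of_int e1 * Y i - (\<Sum>j<n. Q j * W j i) - Z i"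
        using YZ[OF that] by (auto simp: q_def power_add dest: dvd_mult_left)
      ultimately have "of_int (p ^ K) dvd of_int e2 * (of_int e1 * Y i - (\<Sum>j<n. Q j * W j i) - Z i) +
          (of_int e2 * Z i - assemble E z' i)" by (intro dvd_add dvd_mult)
      also have "\<dots> = of_int e2 * (of_int e1 * Y i - (\<Sum>j<n. Q j * W j i)) - assemble E z' i"
        by (simp add: algebra_simps)
      finally have "of_int (p ^ K) dvd
          of_poly N e (of_int e2 * (of_int e1 * Y i - (\<Sum>j<n. Q j * W j i)) - assemble E z' i)"
        by (rule hom_dvd')
      also have "\<dots> = of_int e2 * (of_int e1 * y i - (\<Sum>j<n. of_poly N e (Q j) * V j i)) - \<Phi> z' i"
        by (simp only: \<Theta>.hom_minus \<Theta>.hom_mult \<Theta>.hom_sum \<Theta>.hom_of_int Y_def W_def of_poly_to_poly \<Phi>_def)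
      also have "\<dots> = of_int (e2 * e1) * y i - x i"
        by (simp add: x_def algebra_simps sum_distrib_left)
      finally show ?thesis .
    qed
    moreover have "\<not> p dvd e2 * e1" by (rule prime_or_zero_mult[OF p e2 e1])
    ultimately show "\<exists>e. \<exists>z \<in> lin_span ?S. \<not> p dvd e \<and> (\<forall>j<n. of_int (p ^ K) dvd of_int e * y j - z j)"
      by (intro exI[of _ "e2 * e1"] bexI[of _ x] conjI allI impI)
  qed
qed

lemma approximable_bounded_solutions:
  assumes p: "p = 0 \<or> prime p"
    and A: "\<And>i j. i < m \<Longrightarrow> j < n \<Longrightarrow> A i j \<in> polys_deg_le N d"
  shows "approximable p m n A (bounded_solutions N m n (solution_deg N m d) A)"
  using A
proof (induction N arbitrary: m n A)
  case 0
  show ?case unfolding solution_deg.simps by (rule approximable_0_vars[OF p 0])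
next
  case (Suc N)
  have "approximable p m n A (bounded_solutions (Suc N) m n
    (solution_deg N (m * (2 * (m * d * (m * d + 1) ^ N))) d * (m * d + 1) ^ N + m * d * (m * d + 1) ^ N) A)"
    by (rule approximable_Suc_vars[OF p Suc.prems refl refl]) (auto intro: Suc.IH)
  then show ?case by simp
qed

section \<open>From approximate to exact solutions\<close>

lemma int_subgroup_generator:
  fixes I :: "int set"
  assumes zero: "0 \<in> I" and diff: "\<And>x y. x \<in> I \<Longrightarrow> y \<in> I \<Longrightarrow> x - y \<in> I"
  obtains d where "d \<in> I" "\<forall>x\<in>I. d dvd x"
proof (cases "I = {0}")
  case True
  then show thesis by (intro that[of 0]) auto
next
  case False
  with zero obtain x0 where "x0 \<in> I - {0}" by auto
  then obtain d where d: "d \<in> I - {0}" and min: "\<And>x. x \<in> I - {0} \<Longrightarrow> nat \<bar>d\<bar> \<le> nat \<bar>x\<bar>"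
    using ex_has_least_nat[of "\<lambda>x. x \<in> I - {0}" x0 "\<lambda>x. nat \<bar>x\<bar>"] by blast
  have neg: "- x \<in> I" if "x \<in> I" for x using diff[OF zero that] by simp
  have nat_mult: "int k * d \<in> I" for k
  proof (induction k)
    case (Suc k)
    from diff[OF this neg[of d]] d show ?case by (simp add: algebra_simps)
  qed (simp add: zero)
  have mult: "k * d \<in> I" for k
  proof (cases "k \<ge> 0")
    case True
    then show ?thesis using nat_mult[of "nat k"] by simp
  next
    case False
    then show ?thesis using neg[OF nat_mult[of "nat (- k)"]] by simp
  qed
  show thesis
  proof (rule that)
    show "d \<in> I" using d by simp
    show "\<forall>x\<in>I. d dvd x"
    proof
      fix x assume "x \<in> I"
      then have "x - (x div d) * d \<in> I" by (intro diff mult)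
      then have "x mod d \<in> I" by (simp add: minus_div_mult_eq_mod)
      moreover have "\<bar>x mod d\<bar> < \<bar>d\<bar>" using d by (simp add: abs_mod_less)
      ultimately have "x mod d = 0" using min[of "x mod d"] by force
      then show "d dvd x" by auto
    qed
  qed
qed

section \<open>Finite generation of the bounded solutions\<close>

lemma finite_monomials:
  "finite {m :: nat \<Rightarrow>\<^sub>0 nat. Poly_Mapping.keys m \<subseteq> {..<N} \<and> monom_degree m \<le> b}"
proof -
  let ?S = "{m :: nat \<Rightarrow>\<^sub>0 nat. Poly_Mapping.keys m \<subseteq> {..<N} \<and> monom_degree m \<le> b}"
  let ?r = "\<lambda>m. restrict (Poly_Mapping.lookup m) {..<N}"
  have "?r ` ?S \<subseteq> {..<N} \<rightarrow>\<^sub>E {..b}"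
  proof (rule image_subsetI)
    fix m assume m: "m \<in> ?S"
    have "Poly_Mapping.lookup m i \<le> b" for i
    proof (cases "i \<in> Poly_Mapping.keys m")
      case True
      then have "Poly_Mapping.lookup m i \<le> monom_degree m"
        unfolding monom_degree_def by (intro member_le_sum) auto
      with m show ?thesis by simp
    qed (simp add: in_keys_iff)
    then show "?r m \<in> {..<N} \<rightarrow>\<^sub>E {..b}" by auto
  qed
  then have "finite (?r ` ?S)" by (rule finite_subset) (simp add: finite_PiE)
  moreover have "inj_on ?r ?S"
  proof (rule inj_onI)
    fix m m' assume m: "m \<in> ?S" "m' \<in> ?S" and eq: "?r m = ?r m'"
    show "m = m'"
    proof (rule poly_mapping_eqI)
      fix i
      show "Poly_Mapping.lookup m i = Poly_Mapping.lookup m' i"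
      proof (cases "i < N")
        case True
        with fun_cong[OF eq, of i] show ?thesis by simp
      next
        case False
        with m have "i \<notin> Poly_Mapping.keys m" "i \<notin> Poly_Mapping.keys m'" by auto
        then show ?thesis by (simp add: in_keys_iff)
      qed
    qed
  qed
  ultimately show ?thesis by (rule finite_imageD)
qed

text \<open>As for subgroups of a free abelian group of finite rank: the values of one coordinate
  are the multiples of some \<open>d\<close>. Lift \<open>d\<close> to \<open>h\<close> and subtract
  multiples of \<open>h\<close> to reach the subgroup where this coordinate vanishes. Only closure
  under subtraction is asked of \<open>H\<close>, since multiplication by polynomials breaks a
  degree bound.\<close>

lemma coordinate_subgroup_fg:
  fixes H :: "(nat \<Rightarrow> int_mpoly) set" and C :: "(nat \<times> (nat \<Rightarrow>\<^sub>0 nat)) set"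
  assumes "finite C"
    and "(\<lambda>_. 0) \<in> H" and "\<And>x y. x \<in> H \<Longrightarrow> y \<in> H \<Longrightarrow> (\<lambda>j. x j - y j) \<in> H"
    and "\<And>y. y \<in> H \<Longrightarrow> (\<And>j m. (j, m) \<in> C \<Longrightarrow> Poly_Mapping.lookup (y j) m = 0) \<Longrightarrow> \<forall>j<n. y j = 0"
  shows "\<exists>G. finite G \<and> G \<subseteq> H \<and> (\<forall>y\<in>H. \<exists>z\<in>lin_span G. \<forall>j<n. y j = z j)"
  using assms
proof (induction C arbitrary: H rule: finite_induct)
  case empty
  then have "\<forall>y\<in>H. \<exists>z\<in>lin_span {}. \<forall>j<n. y j = z j"
    by (intro ballI bexI[OF _ lin_span_zero]) auto
  then show ?case by blast
next
  case (insert c C)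
  obtain j0 m0 where c: "c = (j0, m0)" by (cases c)
  let ?c = "\<lambda>y :: nat \<Rightarrow> int_mpoly. Poly_Mapping.lookup (y j0) m0"
  let ?H0 = "{y \<in> H. ?c y = 0}"
  have "\<exists>G. finite G \<and> G \<subseteq> ?H0 \<and> (\<forall>y\<in>?H0. \<exists>z\<in>lin_span G. \<forall>j<n. y j = z j)"
  proof (rule insert.IH)
    show "\<forall>j<n. y j = 0" if "y \<in> ?H0" and "\<And>j m. (j, m) \<in> C \<Longrightarrow> Poly_Mapping.lookup (y j) m = 0" for y
      by (rule insert.prems(3)) (use that c in auto)
  qed (use insert.prems(1,2) in \<open>auto simp: lookup_minus\<close>)
  then obtain G where G: "finite G" "G \<subseteq> ?H0" "\<forall>y\<in>?H0. \<exists>z\<in>lin_span G. \<forall>j<n. y j = z j"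
    by (elim exE conjE)
  obtain d where "d \<in> ?c ` H" and d: "\<forall>x\<in>?c ` H. d dvd x"
  proof (rule int_subgroup_generator[of "?c ` H"])
    show "0 \<in> ?c ` H" using insert.prems(1) by (auto intro!: rev_image_eqI)
    fix x y assume "x \<in> ?c ` H" "y \<in> ?c ` H"
    then obtain u v where uv: "u \<in> H" "v \<in> H" "x = ?c u" "y = ?c v" by auto
    then show "x - y \<in> ?c ` H"
      by (intro rev_image_eqI[OF insert.prems(2)[OF uv(1,2)]]) (simp add: lookup_minus)
  qed
  then obtain h where h: "h \<in> H" "?c h = d" by auto
  have hmult: "(\<lambda>j. of_int k * h j) \<in> H" for k
  proof -
    have neg: "(\<lambda>j. - x j) \<in> H" if "x \<in> H" for x using insert.prems(2)[OF insert.prems(1) that] by simp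
    have pos: "(\<lambda>j. of_int (int k) * h j) \<in> H" for k
    proof (induction k)
      case (Suc k)
      from insert.prems(2)[OF this neg[OF h(1)]] show ?case by (simp add: algebra_simps)
    qed (simp add: insert.prems(1))
    show ?thesis
    proof (cases "k \<ge> 0")
      case True
      then show ?thesis using pos[of "nat k"] by simp
    next
      case False
      then show ?thesis using neg[OF pos[of "nat (- k)"]] by simp
    qed
  qed
  have span_mono: "lin_span G \<subseteq> lin_span (insert h G)"
  proof
    fix z assume "z \<in> lin_span G" then show "z \<in> lin_span (insert h G)"
      by (induction rule: lin_span.induct) (auto intro: lin_span.intros)
  qed
  have "\<exists>z\<in>lin_span (insert h G). \<forall>j<n. y j = z j" if y: "y \<in> H" for y
  proof -
    from d y obtain k where k: "?c y = d * k" by (auto simp: dvd_def)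
    let ?y = "\<lambda>j. y j - of_int k * h j"
    have "?y \<in> ?H0" using insert.prems(2)[OF y hmult] k h(2)
      by (simp add: lookup_minus lookup_of_int_mult)
    from bspec[OF G(3) this] obtain z where z: "z \<in> lin_span G" "\<And>j. j < n \<Longrightarrow> ?y j = z j" by blast
    have "(\<lambda>j. of_int k * h j + z j) \<in> lin_span (insert h G)"
      using z(1) span_mono by (intro lin_span_step) auto
    moreover have "\<forall>j<n. y j = of_int k * h j + z j"
    proof (intro allI impI)
      fix j assume "j < n"
      from z(2)[OF this, symmetric] show "y j = of_int k * h j + z j" by simp
    qed
    ultimately show ?thesis
      by (intro bexI[of _ "\<lambda>j. of_int k * h j + z j"])
  qed
  moreover have "finite (insert h G)" "insert h G \<subseteq> H" using G(1,2) h(1) by auto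
  ultimately show ?case by (intro exI[of _ "insert h G"] conjI ballI)
qed

lemma bounded_solutions_fg:
  "\<exists>G. finite G \<and> G \<subseteq> bounded_solutions N m n b A \<and>
    (\<forall>y \<in> bounded_solutions N m n b A. \<exists>z \<in> lin_span G. \<forall>j<n. y j = z j)"
proof (rule coordinate_subgroup_fg)
  let ?C = "{..<n} \<times> {m. Poly_Mapping.keys m \<subseteq> {..<N} \<and> monom_degree m \<le> b}"
  show "finite ?C" by (simp add: finite_monomials)
  show "(\<lambda>_. 0) \<in> bounded_solutions N m n b A" by (simp add: bounded_solutions_def)
  show "(\<lambda>j. x j - y j) \<in> bounded_solutions N m n b A"
    if "x \<in> bounded_solutions N m n b A" "y \<in> bounded_solutions N m n b A" for x y
    using that by (auto simp: bounded_solutions_def polys_deg_le_diff right_diff_distrib sum_subtractf)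
  show "\<forall>j<n. y j = 0" if y: "y \<in> bounded_solutions N m n b A"
    and 0: "\<And>j m. (j, m) \<in> ?C \<Longrightarrow> Poly_Mapping.lookup (y j) m = 0" for y
  proof (intro allI impI poly_mapping_eqI)
    fix j m assume "j < n"
    show "Poly_Mapping.lookup (y j) m = Poly_Mapping.lookup 0 m"
    proof (cases "m \<in> Poly_Mapping.keys (y j)")
      case True
      with y \<open>j < n\<close> have "(j, m) \<in> ?C" by (auto simp: bounded_solutions_def polys_deg_le_def)
      then show ?thesis using 0 by simp
    qed (simp add: in_keys_iff)
  qed
qed

lemma lin_span_image:
  "z \<in> lin_span (g ` {..<L :: nat}) \<Longrightarrow> \<exists>a. \<forall>j. z j = (\<Sum>k<L. a k * g k j)"
proof (induction rule: lin_span.induct)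
  case lin_span_zero
  then show ?case by (intro exI[of _ "\<lambda>_. 0"]) simp
next
  case (lin_span_step h z c)
  then obtain a i where a: "\<And>j. z j = (\<Sum>k<L. a k * g k j)" and i: "i < L" "h = g i" by auto
  have "c * h j + z j = (\<Sum>k<L. (a(i := a i + c)) k * g k j)" for j
  proof -
    have "(\<Sum>k<L. (a(i := a i + c)) k * g k j) =
        (\<Sum>k<L. a k * g k j + (if k = i then c * g i j else 0))"
      by (intro sum.cong refl) (simp add: algebra_simps)
    then show ?thesis using i by (simp add: sum.distrib a)
  qed
  then show ?case by blast
qed

text \<open>\<open>inM\<close> is membership in the module generated by the \<open>g k\<close>.
  Solutions of higher degree, namely relations among the \<open>g k\<close>, occur only as an
  auxiliary tool in \<open>prime_case\<close>, so they do not enter the degree bound.\<close>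

lemma solution_in_span:
  fixes f :: "nat \<Rightarrow> int_mpoly" and g :: "nat \<Rightarrow> nat \<Rightarrow> int_mpoly"
  assumes f: "\<And>j. j < n \<Longrightarrow> f j \<in> polys_deg_le N d"
    and g: "\<And>k. k < L \<Longrightarrow> g k \<in> bounded_solutions N 1 n (solution_deg N 1 d) (\<lambda>_. f)"
    and gen: "\<And>y. y \<in> bounded_solutions N 1 n (solution_deg N 1 d) (\<lambda>_. f) \<Longrightarrow>
      \<exists>z \<in> lin_span (g ` {..<L}). \<forall>j<n. y j = z j"
    and y: "(\<Sum>j<n. f j * y j) = 0"
  shows "\<exists>a. \<forall>j<n. y j = (\<Sum>k<L. a k * g k j)"
proof -
  let ?B = "bounded_solutions N 1 n (solution_deg N 1 d) (\<lambda>_. f)"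
  define inM where "inM y \<longleftrightarrow> (\<exists>a. \<forall>j<n. y j = (\<Sum>k<L. a k * g k j))" for y
  have inM_cong: "inM x \<longleftrightarrow> inM x'" if "\<And>j. j < n \<Longrightarrow> x j = x' j" for x x'
    using that by (simp add: inM_def)
  have inM_add: "inM (\<lambda>j. x j + x' j)" if "inM x" "inM x'" for x x'
  proof -
    from that obtain a a' where "\<forall>j<n. x j = (\<Sum>k<L. a k * g k j)" "\<forall>j<n. x' j = (\<Sum>k<L. a' k * g k j)"
      by (auto simp: inM_def)
    then show ?thesis unfolding inM_def
      by (intro exI[of _ "\<lambda>k. a k + a' k"]) (simp add: distrib_right sum.distrib)
  qed
  have inM_mult: "inM (\<lambda>j. c * x j)" if "inM x" for c x
  proof -
    from that obtain a where "\<forall>j<n. x j = (\<Sum>k<L. a k * g k j)" by (auto simp: inM_def)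
    then show ?thesis unfolding inM_def
      by (intro exI[of _ "\<lambda>k. c * a k"]) (simp add: sum_distrib_left mult.assoc)
  qed
  have span_inM: "inM z \<and> (\<Sum>j<n. f j * z j) = 0" if "z \<in> lin_span ?B" for z
    using that
  proof (induction rule: lin_span.induct)
    case lin_span_zero
    then show ?case by (auto simp: inM_def intro!: exI[of _ "\<lambda>_. 0"])
  next
    case (lin_span_step h z a)
    from gen[OF this(1)] obtain z' where "z' \<in> lin_span (g ` {..<L})" "\<forall>j<n. h j = z' j" by blast
    with lin_span_image[of z' g L] have "inM h" by (auto simp: inM_def)
    moreover have "(\<Sum>j<n. f j * h j) = 0" using lin_span_step(1) by (simp add: bounded_solutions_def)
    moreover have "(\<Sum>j<n. f j * (a * h j + z j)) = a * (\<Sum>j<n. f j * h j) + (\<Sum>j<n. f j * z j)"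
      by (simp add: distrib_left sum.distrib sum_distrib_left mult_ac)
    ultimately show ?case using lin_span_step by (simp add: inM_add inM_mult)
  qed
  have appr: "approximable p 1 n (\<lambda>_. f) ?B" if "p = 0 \<or> prime p" for p
    by (rule approximable_bounded_solutions[OF that]) (rule f)
  have torsion: "\<exists>e. e \<noteq> 0 \<and> inM (\<lambda>j. of_int e * x j)" if x: "(\<Sum>j<n. f j * x j) = 0" for x
  proof -
    obtain c where c: "\<forall>K>0. \<forall>y. (\<forall>i<1::nat. of_int (0 ^ (K + c)) dvd (\<Sum>j<n. f j * y j)) \<longrightarrow>
        (\<exists>e. \<exists>z \<in> lin_span ?B. \<not> (0 :: int) dvd e \<and> (\<forall>j<n. of_int (0 ^ K) dvd of_int e * y j - z j))"
      using appr[of 0] unfolding approximable_def by blast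
    from c[rule_format, of 1 x] x obtain e z where
      e: "e \<noteq> 0" and z: "z \<in> lin_span ?B" "\<forall>j<n. of_int e * x j = z j"
      by auto
    have "inM (\<lambda>j. of_int e * x j) \<longleftrightarrow> inM z" by (rule inM_cong) (simp add: z(2))
    with span_inM[OF z(1)] e show ?thesis by blast
  qed
  have prime_case: "\<exists>e. \<not> p dvd e \<and> inM (\<lambda>j. of_int e * y j)" if p: "prime p" for p :: int
  proof -
    have "p \<noteq> 0" using p by auto
    have gdeg: "g k j \<in> polys_deg_le N (solution_deg N 1 d)" if "k < L" "j < n" for k j
      using g[OF that(1)] that(2) by (simp add: bounded_solutions_def)
    \<comment> \<open>Exact relations among the generators: the \<open>n\<close> coordinates are the
      rows and the \<open>L\<close> generators the columns. Only the precision loss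
      \<open>c1\<close> of this system is kept.\<close>
    let ?G = "bounded_solutions N n L (solution_deg N n (solution_deg N 1 d)) (\<lambda>j k. g k j)"
    have "approximable p n L (\<lambda>j k. g k j) ?G"
      by (rule approximable_bounded_solutions) (use p gdeg in auto)
    then obtain c1 where c1: "\<And>K a. K > 0 \<Longrightarrow>
      (\<forall>j<n. of_int (p ^ (K + c1)) dvd (\<Sum>k<L. g k j * a k)) \<Longrightarrow>
      (\<exists>e. \<exists>z \<in> lin_span ?G. \<not> p dvd e \<and> (\<forall>k<L. of_int (p ^ K) dvd of_int e * a k - z k))"
      unfolding approximable_def by blast
    have span_G: "(\<Sum>k<L. g k j * z k) = 0" if "z \<in> lin_span ?G" "j < n" for z j
      using that(1)
    proof (induction rule: lin_span.induct)
      case (lin_span_step h z a)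
      have "(\<Sum>k<L. g k j * (a * h k + z k)) = a * (\<Sum>k<L. g k j * h k) + (\<Sum>k<L. g k j * z k)"
        by (simp add: distrib_left sum.distrib sum_distrib_left mult_ac)
      with lin_span_step that(2) show ?case by (simp add: bounded_solutions_def)
    qed simp
    \<comment> \<open>If \<open>p ^ l * x\<close> has coefficients \<open>a\<close>, then
      \<open>p ^ Suc c1 * a\<close> is a relation among the generators modulo
      \<open>p ^ (Suc l + c1)\<close>. Up to a factor \<open>e\<close> it differs from an exact
      relation by \<open>p ^ Suc l * w\<close>. Applying the generators and dividing by
      \<open>p ^ Suc l\<close> shows that \<open>e * p ^ c1 * x\<close> has coefficients
      \<open>w\<close>. Here \<open>c1\<close> is independent of \<open>l\<close> and
      \<open>x\<close>, and \<open>Suc l\<close> keeps the precision positive.\<close>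
    have bounded_torsion: "\<exists>e. \<not> p dvd e \<and> inM (\<lambda>j. of_int (e * p ^ c1) * x j)"
      if "inM (\<lambda>j. of_int (p ^ l) * x j)" for l x
    proof -
      from that obtain a where a: "\<And>j. j < n \<Longrightarrow> of_int (p ^ l) * x j = (\<Sum>k<L. a k * g k j)"
        by (auto simp: inM_def)
      define r where "r = (of_int (p ^ Suc c1) :: int_mpoly)"
      have "\<forall>j<n. of_int (p ^ (Suc l + c1)) dvd (\<Sum>k<L. g k j * (r * a k))"
      proof (intro allI impI)
        fix j assume "j < n"
        have "(\<Sum>k<L. g k j * (r * a k)) = r * (of_int (p ^ l) * x j)"
          unfolding a[OF \<open>j < n\<close>] by (simp add: sum_distrib_left mult_ac)
        also have "\<dots> = of_int (p ^ (Suc l + c1)) * x j" by (simp add: r_def power_add mult_ac)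
        finally show "of_int (p ^ (Suc l + c1)) dvd (\<Sum>k<L. g k j * (r * a k))" by simp
      qed
      from c1[OF zero_less_Suc this] obtain e z where e: "\<not> p dvd e" and z: "z \<in> lin_span ?G"
        and az: "\<And>k. k < L \<Longrightarrow> of_int (p ^ Suc l) dvd of_int e * (r * a k) - z k" by blast
      from az have "\<forall>k. \<exists>w. k < L \<longrightarrow> of_int e * (r * a k) - z k = of_int (p ^ Suc l) * w"
        unfolding dvd_def by blast
      then obtain w where w: "\<And>k. k < L \<Longrightarrow> of_int e * (r * a k) - z k = of_int (p ^ Suc l) * w k"
        by metis
      have "of_int (e * p ^ c1) * x j = (\<Sum>k<L. w k * g k j)" if "j < n" for j
      proof -
        have "of_int (p ^ Suc l) * (\<Sum>k<L. w k * g k j) =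
            (\<Sum>k<L. (of_int e * (r * a k) - z k) * g k j)"
          by (simp add: w sum_distrib_left mult.assoc)
        also have "\<dots> = of_int e * r * (\<Sum>k<L. a k * g k j) - (\<Sum>k<L. g k j * z k)"
          by (simp only: left_diff_distrib sum_subtractf) (simp add: sum_distrib_left mult_ac)
        also have "\<dots> = of_int e * r * (of_int (p ^ l) * x j)"
          by (simp only: span_G[OF z that] a[OF that] diff_0_right)
        also have "\<dots> = of_int (p ^ Suc l) * (of_int (e * p ^ c1) * x j)"
          by (simp add: r_def mult_ac)
        finally show ?thesis using \<open>p \<noteq> 0\<close> by simp
      qed
      then have "inM (\<lambda>j. of_int (e * p ^ c1) * x j)" unfolding inM_def by blast
      with e show ?thesis by blast
    qed
    obtain c where c: "\<And>K y. K > 0 \<Longrightarrow> of_int (p ^ (K + c)) dvd (\<Sum>j<n. f j * y j) \<Longrightarrow>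
        (\<exists>e. \<exists>z \<in> lin_span ?B. \<not> p dvd e \<and> (\<forall>j<n. of_int (p ^ K) dvd of_int e * y j - z j))"
      using appr[of p] p unfolding approximable_def by blast
    \<comment> \<open>The precision \<open>Suc c1\<close> is positive and provides the power
      \<open>p ^ c1\<close> that \<open>bounded_torsion\<close> asks for when applied to the
      remainder \<open>y'\<close>.\<close>
    obtain e z where e: "\<not> p dvd e" and z: "z \<in> lin_span ?B"
      and yz: "\<And>j. j < n \<Longrightarrow> of_int (p ^ Suc c1) dvd of_int e * y j - z j"
      using c[of "Suc c1" y] y by auto
    from yz have "\<forall>j. \<exists>w. j < n \<longrightarrow> of_int e * y j - z j = of_int (p ^ Suc c1) * w"
      unfolding dvd_def by blast
    then obtain y' where y': "\<And>j. j < n \<Longrightarrow> of_int e * y j - z j = of_int (p ^ Suc c1) * y' j"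
      by metis
    have "of_int (p ^ Suc c1) * (\<Sum>j<n. f j * y' j) = (\<Sum>j<n. f j * (of_int e * y j - z j))"
      by (simp add: y' sum_distrib_left mult_ac)
    also have "\<dots> = of_int e * (\<Sum>j<n. f j * y j) - (\<Sum>j<n. f j * z j)"
      by (simp add: right_diff_distrib sum_subtractf sum_distrib_left mult_ac)
    also have "\<dots> = 0" using y span_inM[OF z] by simp
    finally have "(\<Sum>j<n. f j * y' j) = 0" using \<open>p \<noteq> 0\<close> by simp
    from torsion[OF this] obtain e' where e': "e' \<noteq> 0" "inM (\<lambda>j. of_int e' * y' j)" by blast
    \<comment> \<open>The part of \<open>e'\<close> prime to \<open>p\<close> may stay as a factor;
      its \<open>p\<close>-part is traded for \<open>p ^ c1\<close> by
      \<open>bounded_torsion\<close>.\<close>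
    obtain e1 where e1: "e' = p ^ multiplicity p e' * e1" "\<not> p dvd e1"
      using multiplicity_decompose'[OF e'(1), of p] not_prime_unit p by blast
    have "inM (\<lambda>j. of_int (p ^ multiplicity p e') * (of_int e1 * y' j))"
    proof -
      have "of_int e' * y' j = of_int (p ^ multiplicity p e') * (of_int e1 * y' j)" for j
        using arg_cong[OF e1(1), of "\<lambda>e. of_int e * y' j"] by (simp add: mult.assoc)
      with e'(2) show ?thesis by simp
    qed
    from bounded_torsion[OF this] obtain e2 where e2: "\<not> p dvd e2"
      "inM (\<lambda>j. of_int (e2 * p ^ c1) * (of_int e1 * y' j))" by blast
    have "inM (\<lambda>j. of_int (e2 * e1) * z j + of_int p * (of_int (e2 * p ^ c1) * (of_int e1 * y' j)))"
      by (intro inM_add inM_mult e2(2)) (use span_inM[OF z] in simp)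
    also have "?this \<longleftrightarrow> inM (\<lambda>j. of_int (e2 * e1 * e) * y j)"
    proof (rule inM_cong)
      fix j assume "j < n"
      have "of_int (e2 * e1 * e) * y j = of_int (e2 * e1) * z j + of_int (e2 * e1) * (of_int e * y j - z j)"
        by (simp add: algebra_simps)
      then show "of_int (e2 * e1) * z j + of_int p * (of_int (e2 * p ^ c1) * (of_int e1 * y' j)) =
          of_int (e2 * e1 * e) * y j"
        unfolding y'[OF \<open>j < n\<close>] by (simp add: mult_ac)
    qed
    finally have "inM (\<lambda>j. of_int (e2 * e1 * e) * y j)" .
    moreover have "\<not> p dvd e2 * e1 * e"
      using e e1(2) e2(1) p by (auto dest: prime_dvd_multD)
    ultimately show ?thesis by blast
  qed
  let ?I = "{e. inM (\<lambda>j. of_int e * y j)}"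
  have zero: "0 \<in> ?I" by (auto simp: inM_def intro!: exI[of _ "\<lambda>_. 0"])
  have diff: "e - e' \<in> ?I" if "e \<in> ?I" "e' \<in> ?I" for e e'
    using inM_add[of "\<lambda>j. of_int e * y j" "\<lambda>j. - 1 * (of_int e' * y j)"] inM_mult[of _ "- 1"] that
    by (simp add: left_diff_distrib)
  obtain e where e: "e \<in> ?I" "\<forall>x\<in>?I. e dvd x"
    by (rule int_subgroup_generator[of ?I, OF zero], rule diff, assumption, assumption)
  have "is_unit e"
  proof (rule ccontr)
    assume "\<not> is_unit e"
    \<comment> \<open>If \<open>e\<close> were 0, then 0 would be the only element of
      \<open>?I\<close>, contradicting the odd element that \<open>prime_case\<close> gives for
      2.\<close>
    have "e \<noteq> 0" using prime_case[of 2] e(2) by auto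
    with \<open>\<not> is_unit e\<close> obtain p where p: "prime p" "p dvd e" using prime_divisor_exists by blast
    from prime_case[OF p(1)] obtain x where "\<not> p dvd x" "x \<in> ?I" by auto
    with e(2) p(2) show False by (meson dvd_trans)
  qed
  then have "\<bar>e\<bar> = 1" by simp
  then have "e = 1 \<or> e = - 1" by linarith
  with e(1) diff[OF zero e(1)] have "1 \<in> ?I" by auto
  then show ?thesis by (simp add: inM_def)
qed

section \<open>Growth of the degree bound\<close>

lemma solution_deg_0: "solution_deg N m 0 = 0"
  by (induction N arbitrary: m) auto

text \<open>The exponent of \<open>B = 2 * m * d\<close> in the bound for
  \<open>solution_deg\<close>. Eliminating a variable replaces \<open>B\<close> by at most
  \<open>B ^ (N + 2)\<close>, which multiplies the exponent by \<open>N + 2\<close>. The factor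
  \<open>e ^ N\<close>, the summand \<open>E\<close> and a final factor 2 account for the added
  \<open>N + 2\<close>.\<close>

fun deg_exp :: "nat \<Rightarrow> nat" where
  "deg_exp 0 = 0"
| "deg_exp (Suc N) = (N + 2) * deg_exp N + N + 2"

text \<open>\<open>deg_exp N + 1\<close> grows by a factor of at most
  \<open>N + 3 \<le> 2 ^ (4 * N + 2)\<close>, and \<open>4 * N + 2\<close> is exactly the difference
  between \<open>2 * (Suc N)\<^sup>2\<close> and \<open>2 * N\<^sup>2\<close>.\<close>

lemma deg_exp_le: "deg_exp N + 1 \<le> 2 ^ (2 * N\<^sup>2)"
proof (induction N)
  case (Suc N)
  have "N + 3 \<le> 2 ^ (N + 2)"
    by (induction N) auto
  also have "(2 :: nat) ^ (N + 2) \<le> 2 ^ (4 * N + 2)" by (rule power_increasing) auto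
  finally have 1: "N + 3 \<le> 2 ^ (4 * N + 2)" .
  have "deg_exp (Suc N) + 1 \<le> (N + 3) * (deg_exp N + 1)" by (simp add: algebra_simps)
  also have "\<dots> \<le> 2 ^ (4 * N + 2) * 2 ^ (2 * N\<^sup>2)" using 1 Suc.IH by (rule mult_le_mono)
  also have "\<dots> = 2 ^ (2 * (Suc N)\<^sup>2)"
    by (simp add: power2_eq_square algebra_simps flip: power_add)
  finally show ?case .
qed simp

lemma solution_deg_le:
  assumes "m > 0" "d > 0"
  shows "solution_deg N m d \<le> (2 * m * d) ^ deg_exp N"
  using assms
proof (induction N arbitrary: m)
  case (Suc N)
  define B where "B = 2 * m * d"
  define e where "e = m * d + 1"
  define E where "E = m * d * e ^ N"
  have md: "1 \<le> m * d" using Suc.prems by simp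
  have B: "2 \<le> B" using md by (simp add: B_def mult.assoc)
  have "e \<le> B" using md by (simp add: e_def B_def mult.assoc)
  then have eN: "e ^ N \<le> B ^ N" by (rule power_mono) simp
  then have E: "2 * E \<le> B ^ (N + 1)" by (simp add: E_def B_def mult_ac mult_le_mono)
  have "E > 0" using md by (simp add: E_def e_def)
  have "solution_deg N (m * (2 * E)) d \<le> (2 * (m * (2 * E)) * d) ^ deg_exp N"
    by (rule Suc.IH) (use Suc.prems \<open>E > 0\<close> in auto)
  also have "2 * (m * (2 * E)) * d = B * (2 * E)" by (simp add: B_def)
  also have "(B * (2 * E)) ^ deg_exp N \<le> (B * B ^ (N + 1)) ^ deg_exp N"
    using E by (intro power_mono mult_le_mono) auto
  also have "B * B ^ (N + 1) = B ^ (N + 2)" by simp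
  also have "(B ^ (N + 2)) ^ deg_exp N = B ^ ((N + 2) * deg_exp N)" by (rule power_mult[symmetric])
  finally have IH: "solution_deg N (m * (2 * E)) d \<le> B ^ ((N + 2) * deg_exp N)" .
  let ?k = "(N + 2) * deg_exp N + N + 1"
  have "solution_deg (Suc N) m d = solution_deg N (m * (2 * E)) d * e ^ N + E"
    by (simp add: E_def e_def)
  also have "\<dots> \<le> B ^ ((N + 2) * deg_exp N) * B ^ N + B ^ (N + 1)"
    using IH eN E by (intro add_mono mult_le_mono) auto
  also have "\<dots> \<le> B ^ ?k + B ^ ?k"
  proof (rule add_mono)
    show "B ^ ((N + 2) * deg_exp N) * B ^ N \<le> B ^ ?k"
      unfolding power_add[symmetric] by (rule power_increasing) (use B in auto)
    show "B ^ (N + 1) \<le> B ^ ?k" by (rule power_increasing) (use B in auto)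
  qed
  also have "\<dots> = 2 * B ^ ?k" by simp
  also have "\<dots> \<le> B * B ^ ?k" using B by (rule mult_le_mono1)
  also have "\<dots> = B ^ deg_exp (Suc N)" by simp
  finally show ?case by (simp only: B_def)
qed simp

lemma solution_deg_bound:
  "real (solution_deg N 1 d) \<le> (2 * real d) powr (2 powr (2 * (real N)\<^sup>2))"
\<comment> \<open>For \<open>d = 0\<close> the right side is a power of base 0, which
  \<open>powr\<close> makes 0, and \<open>solution_deg\<close> is 0 as well.\<close>
proof (cases "d = 0")
  case False
  then have "solution_deg N 1 d \<le> (2 * d) ^ deg_exp N" using solution_deg_le[of 1 d N] by simp
  then have "real (solution_deg N 1 d) \<le> real ((2 * d) ^ deg_exp N)" by (rule of_nat_mono)
  also have "\<dots> = (2 * real d) powr real (deg_exp N)"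
    using False by (simp add: powr_realpow)
  also have "\<dots> \<le> (2 * real d) powr (2 powr (2 * (real N)\<^sup>2))"
  proof (rule powr_mono)
    have "real (deg_exp N) \<le> real (2 ^ (2 * N\<^sup>2))" using deg_exp_le[of N] by (intro of_nat_mono) simp
    also have "\<dots> = 2 powr real (2 * N\<^sup>2)" by (simp only: powr_realpow of_nat_power of_nat_numeral zero_less_numeral)
    finally show "real (deg_exp N) \<le> 2 powr (2 * (real N)\<^sup>2)" by simp
  qed (use False in simp)
  finally show ?thesis .
qed (simp add: solution_deg_0)

section \<open>Restriction to \<open>N\<close> variables and conclusion\<close>

lemma polys_in_iff: "p \<in> polys_in N \<longleftrightarrow> (\<exists>d. p \<in> polys_deg_le N d)"
proof
  assume "p \<in> polys_in N"
  moreover have "monom_degree m \<le> (\<Sum>m \<in> Poly_Mapping.keys p. monom_degree m)"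
    if "m \<in> Poly_Mapping.keys p" for m using that by (intro member_le_sum) auto
  ultimately show "\<exists>d. p \<in> polys_deg_le N d" by (auto simp: polys_in_def polys_deg_le_def)
qed (auto dest: polys_deg_leD)

lemma polys_in_add: "p \<in> polys_in N \<Longrightarrow> q \<in> polys_in N \<Longrightarrow> p + q \<in> polys_in N"
  unfolding polys_in_iff
  by (metis polys_deg_le_add polys_deg_le_mono max.cobounded1 max.cobounded2)

lemma polys_in_mult: "p \<in> polys_in N \<Longrightarrow> q \<in> polys_in N \<Longrightarrow> p * q \<in> polys_in N"
  unfolding polys_in_iff by (metis polys_deg_le_mult)

lemma polys_in_sum: "(\<And>i. i \<in> I \<Longrightarrow> p i \<in> polys_in N) \<Longrightarrow> sum p I \<in> polys_in N"
  by (induction I rule: infinite_finite_induct)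
    (auto intro: polys_in_add polys_deg_leD[OF polys_deg_le_0])

text \<open>A ring homomorphism fixing the polynomials in the first \<open>N\<close> variables.
  Applied to a representation of such a polynomial by such generators, it moves the coefficients
  into the same ring.\<close>

definition retract :: "nat \<Rightarrow> int_mpoly \<Rightarrow> int_mpoly" where
  "retract N = subst (\<lambda>i. if i < N then var i else 0)"

lemma retract_id: "p \<in> polys_in N \<Longrightarrow> retract N p = p"
  unfolding retract_def
  by (subst (2) subst_var_id[symmetric], rule subst_cong) (auto simp: polys_in_def)

text \<open>A polynomial involves finitely many variables, so \<open>subst_filtration\<close>
  applies, here with the constant family \<open>polys_in N\<close>.\<close>

lemma retract_in: "retract N p \<in> polys_in N"
proof -
  have "finite (\<Union>m \<in> Poly_Mapping.keys p. Poly_Mapping.keys m)" by simp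
  then obtain M where "(\<Union>m \<in> Poly_Mapping.keys p. Poly_Mapping.keys m) \<subseteq> {..<M}"
    using finite_nat_iff_bounded by blast
  then have "p \<in> polys_in M" by (auto simp: polys_in_def)
  then obtain d where d: "p \<in> polys_deg_le M d" by (auto simp: polys_in_iff)
  show ?thesis unfolding retract_def
  proof (rule subst_filtration[OF d, of _ "\<lambda>_. polys_in N"])
    show "(if i < N then var i else 0) \<in> polys_in N" for i
      using var_in[of i N 1] by (auto intro: polys_deg_leD[of _ N 1])
    show "of_int c \<in> polys_in N" for c by (rule polys_deg_leD[OF polys_deg_le_of_int[of c N 0]])
  qed (auto intro: polys_in_add polys_in_mult)
qed

lemma total_degree_le_iff:
  "p \<in> polys_in N \<Longrightarrow> total_degree p \<le> ereal (real d) \<longleftrightarrow> p \<in> polys_deg_le N d"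
  by (cases "p = 0") (auto simp: total_degree_def polys_in_def polys_deg_le_def)

theorem theoremB:
  shows "\<exists>c::real. c > 0 \<and>
    (\<forall>(N::nat) (n::nat) (d::nat) (f :: nat \<Rightarrow> int_mpoly).
      (\<forall>i<n. f i \<in> polys_in N \<and> total_degree (f i) \<le> ereal (real d)) \<longrightarrow>
      (\<exists>(K::nat) (y :: nat \<Rightarrow> nat \<Rightarrow> int_mpoly).
        (\<forall>k<K. y k \<in> solutions N n f) \<and>
        (\<forall>k<K. \<forall>i<n. total_degree (y k i)
            \<le> ereal ((2 * real d) powr (2 powr (c * (real N)\<^sup>2)))) \<and>
        solutions N n f = generated_module N n K y))"
proof (rule exI[of _ 2], intro conjI allI impI)
  \<comment> \<open>The witness 2 is the factor in the exponent \<open>2 * N\<^sup>2\<close> of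
    \<open>deg_exp_le\<close>.\<close>
  fix N n d :: nat and f :: "nat \<Rightarrow> int_mpoly"
  assume "\<forall>i<n. f i \<in> polys_in N \<and> total_degree (f i) \<le> ereal (real d)"
  then have f: "f i \<in> polys_deg_le N d" if "i < n" for i
    using that total_degree_le_iff[of "f i" N d] by simp
  let ?B = "bounded_solutions N 1 n (solution_deg N 1 d) (\<lambda>_. f)"
  obtain G where G: "finite G" "G \<subseteq> ?B" "\<forall>y\<in>?B. \<exists>z\<in>lin_span G. \<forall>j<n. y j = z j"
    using bounded_solutions_fg[of N 1 n "solution_deg N 1 d" "\<lambda>_. f"] by (elim exE conjE)
  obtain K g where Kg: "G = g ` {..<K :: nat}"
    using \<open>finite G\<close> by (metis finite_conv_nat_seg_image lessThan_def)
  have g: "g k \<in> ?B" if "k < K" for k using G(2) that by (auto simp: Kg)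
  \<comment> \<open>Members of \<open>poly_tuples\<close> are \<open>undefined\<close> outside
    \<open>{..<n}\<close>, while the values of \<open>g k\<close> there are arbitrary.\<close>
  define y where "y k = restrict (g k) {..<n}" for k
  have sol: "y k \<in> solutions N n f" if "k < K" for k
    using g[OF that] by (auto simp: y_def solutions_def poly_tuples_def bounded_solutions_def
        dest: polys_deg_leD)
  have deg: "total_degree (y k i) \<le> ereal ((2 * real d) powr (2 powr (2 * (real N)\<^sup>2)))"
    if "k < K" "i < n" for k i
  proof -
    have "y k i \<in> polys_deg_le N (solution_deg N 1 d)"
      using g[OF that(1)] that(2) by (simp add: y_def bounded_solutions_def)
    then have "total_degree (y k i) \<le> ereal (real (solution_deg N 1 d))"
      by (subst total_degree_le_iff) (auto dest: polys_deg_leD)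
    also have "\<dots> \<le> ereal ((2 * real d) powr (2 powr (2 * (real N)\<^sup>2)))"
      using solution_deg_bound[of N d] by simp
    finally show ?thesis .
  qed
  have "solutions N n f = generated_module N n K y"
  proof (intro Set.set_eqI iffI)
    fix x assume x: "x \<in> solutions N n f"
    then have x_in: "x j \<in> polys_in N" if "j < n" for j
      using that by (auto simp: solutions_def poly_tuples_def)
    have "\<exists>a. \<forall>j<n. x j = (\<Sum>k<K. a k * g k j)"
    proof (rule solution_in_span[OF f g])
      show "(\<Sum>j<n. f j * x j) = 0" using x by (simp add: solutions_def)
      show "\<exists>z\<in>lin_span (g ` {..<K}). \<forall>j<n. y j = z j" if "y \<in> ?B" for y
        using bspec[OF G(3) that] by (simp add: Kg)
    qed
    then obtain a where a: "\<And>j. j < n \<Longrightarrow> x j = (\<Sum>k<K. a k * g k j)" by blast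
    interpret r: comm_ring_hom "retract N" unfolding retract_def by (rule comm_ring_hom_subst)
    \<comment> \<open>\<open>retract N\<close> fixes \<open>x j\<close> and every
      \<open>g k j\<close>, so only the coefficients \<open>a k\<close> change.\<close>
    have "x j = (\<Sum>k<K. retract N (a k) * y k j)" if "j < n" for j
    proof -
      have "g k j \<in> polys_in N" if "k < K" for k
        using g[OF that] \<open>j < n\<close> by (auto simp: bounded_solutions_def dest: polys_deg_leD)
      then show ?thesis
        using arg_cong[OF a[OF that], of "retract N"] that
        by (simp add: r.hom_sum r.hom_mult retract_id x_in y_def)
    qed
    moreover have "x \<in> extensional {..<n}" using x by (auto simp: solutions_def poly_tuples_def PiE_def)
    ultimately have "x = (\<lambda>i\<in>{..<n}. \<Sum>k<K. retract N (a k) * y k i)"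
      by (intro extensionalityI[of _ "{..<n}"]) auto
    then show "x \<in> generated_module N n K y"
      unfolding generated_module_def by (intro CollectI exI[of _ "\<lambda>k. retract N (a k)"]) (simp add: retract_in)
  next
    fix x assume "x \<in> generated_module N n K y"
    then obtain a where x: "x = (\<lambda>i\<in>{..<n}. \<Sum>k<K. a k * y k i)" and a: "\<forall>k<K. a k \<in> polys_in N"
      by (auto simp: generated_module_def)
    have y_in: "y k i \<in> polys_in N" if "k < K" "i < n" for k i
      using sol[OF that(1)] that(2) by (auto simp: solutions_def poly_tuples_def)
    have "(\<Sum>i<n. f i * (\<Sum>k<K. a k * y k i)) = (\<Sum>k<K. a k * (\<Sum>i<n. f i * y k i))"
      unfolding sum_distrib_left by (subst sum.swap) (simp add: mult_ac)
    also have "\<dots> = 0" by (rule sum.neutral) (use sol in \<open>simp add: solutions_def\<close>)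
    finally show "x \<in> solutions N n f"
      using a y_in by (auto simp: x solutions_def poly_tuples_def intro!: polys_in_sum polys_in_mult)
  qed
  with sol deg show "\<exists>K y. (\<forall>k<K. y k \<in> solutions N n f) \<and>
      (\<forall>k<K. \<forall>i<n. total_degree (y k i) \<le> ereal ((2 * real d) powr (2 powr (2 * (real N)\<^sup>2)))) \<and>
      solutions N n f = generated_module N n K y"
    by (intro exI[of _ K] exI[of _ y] conjI allI impI)
qed simp

end
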